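(* Let $(X,d)$ be a compact, perfect metric space, and let $f_i: X \to X$, $1\le i\le N$, be infinitesimal similitudes on $X$ such that for each $i$ the map $x\mapsto (Df_i)(x)$ is a strictly positive Hölder continuous function on $X$. Assume that each $f_i$ is a contraction map with contraction coefficient $c_i<1$, and let $A$ denote the unique non-empty compact set with $A=\bigcup_{i=1}^N f_i(A)$. Further assume that the maps $f_i$, $1\le i\le N$, are one-to-one on $A$ and satisfy the strong open set condition. Then the Hausdorff dimension of $A$ is given by the unique $\sigma_0\ge 0$ such that $r(L_{\sigma_0})=1$.
   Context: For a map $f:(X,d_X)\to (Y,d_Y)$ between metric spaces and $x\in X$, let $(Df)^*(x)\subset\mathbb{R}$ be the set of all real limits $\lim_{n\to\infty} \frac{d_Y(f(x_n),f(y_n))}{d_X(x_n,y_n)}$, over sequences $(x_n),(y_n)$ in $X$ with $x_n\neq y_n$ for all $n$, $x_n\to x$, $y_n\to x$, for which the limit exists. $f$ is an infinitesimal similitude at $x$ if $(Df)^*(x)$ is a nonempty singleton; its element is then denoted $(Df)(x)$. $f$ is an infinitesimal similitude on $X$ if it is one at every $x\in X$. A map $f:X\to X$ is a contraction with coefficient $c<1$ if $d(f(x),f(y))\le c\,d(x,y)$ for all $x,y\in X$. The strong open set condition (SOSC) for $\{X;f_1,\dots,f_N\}$ with attractor $A$: there is an open set $U\subseteq X$ with $U\cap A\ne\emptyset$, $f_i(U)\subseteq U$ for all $i$, and $f_i(U)\cap f_j(U)=\emptyset$ for $i\neq j$. For $\sigma\ge 0$, $L_\sigma:\mathcal{C}(X)\to\mathcal{C}(X)$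 is the bounded linear operator on the space of real continuous functions (sup norm) given by $(L_\sigma g)(x)=\sum_{i=1}^N \big((Df_i)(x)\big)^\sigma g(f_i(x))$, and $r(L_\sigma)$ is its spectral radius. It is known that there is a unique $\sigma_0\ge0$ with $r(L_{\sigma_0})=1$. *)

theory Defs
  imports "HOL-Analysis.Analysis"
begin

definition inf_derivs :: "('a::metric_space \<Rightarrow> 'b::metric_space) \<Rightarrow> 'a \<Rightarrow> real set" where
  "inf_derivs f x = {l. \<exists>u v. (\<forall>n. u n \<noteq> v n) \<and> u \<longlonglongrightarrow> x \<and> v \<longlonglongrightarrow> x \<and>
      (\<lambda>n. dist (f (u n)) (f (v n)) / dist (u n) (v n)) \<longlonglongrightarrow> l}"

definition inf_similitude_at :: "('a::metric_space \<Rightarrow> 'b::metric_space) \<Rightarrow> 'a \<Rightarrow> bool" where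
  "inf_similitude_at f x \<longleftrightarrow> is_singleton (inf_derivs f x)"

definition inf_similitude :: "('a::metric_space \<Rightarrow> 'b::metric_space) \<Rightarrow> bool" where
  "inf_similitude f \<longleftrightarrow> (\<forall>x. inf_similitude_at f x)"

text \<open>Only meaningful at points where \<open>f\<close> is an infinitesimal similitude.\<close>

definition inf_deriv :: "('a::metric_space \<Rightarrow> 'b::metric_space) \<Rightarrow> 'a \<Rightarrow> real" where
  "inf_deriv f x = the_elem (inf_derivs f x)"

definition hoelder_continuous :: "('a::metric_space \<Rightarrow> real) \<Rightarrow> bool" where
  "hoelder_continuous g \<longleftrightarrow> (\<exists>C \<alpha>. 0 \<le> C \<and> 0 < \<alpha> \<and> \<alpha> \<le> 1 \<and>
      (\<forall>x y. \<bar>g x - g y\<bar> \<le> C * dist x y powr \<alpha>))"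

definition contraction_with :: "real \<Rightarrow> ('a::metric_space \<Rightarrow> 'a) \<Rightarrow> bool" where
  "contraction_with c f \<longleftrightarrow> c < 1 \<and> (\<forall>x y. dist (f x) (f y) \<le> c * dist x y)"

definition strong_open_set_condition ::
    "nat \<Rightarrow> (nat \<Rightarrow> 'a::metric_space \<Rightarrow> 'a) \<Rightarrow> 'a set \<Rightarrow> bool" where
  "strong_open_set_condition N f A \<longleftrightarrow> (\<exists>U. open U \<and> U \<inter> A \<noteq> {} \<and>
      (\<forall>i\<in>{1..N}. f i ` U \<subseteq> U) \<and>
      (\<forall>i\<in>{1..N}. \<forall>j\<in>{1..N}. i \<noteq> j \<longrightarrow> f i ` U \<inter> f j ` U = {}))"

text \<open>
  On a compact space \<open>X\<close> every real continuous function is bounded, so the type of bounded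
  continuous functions with its supremum norm is \<open>C(X)\<close>.  \<open>Bcontfun\<close> is unspecified unless its
  argument is bounded and continuous; the two lemmas below show that this is so whenever
  \<open>X\<close> is compact and the \<open>f i\<close> and their infinitesimal derivatives are continuous
  with positive derivatives.
\<close>

definition transfer_op ::
    "nat \<Rightarrow> (nat \<Rightarrow> 'a::metric_space \<Rightarrow> 'a) \<Rightarrow> real \<Rightarrow> ('a \<Rightarrow>\<^sub>C real) \<Rightarrow> ('a \<Rightarrow>\<^sub>C real)" where
  "transfer_op N f \<sigma> g =
     Bcontfun (\<lambda>x. \<Sum>i = 1..N. inf_deriv (f i) x powr \<sigma> * apply_bcontfun g (f i x))"

lemma apply_transfer_op:
  fixes f :: "nat \<Rightarrow> 'a::metric_space \<Rightarrow> 'a"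
  assumes "compact (UNIV :: 'a set)"
    and "\<forall>i\<in>{1..N}. continuous_on UNIV (f i)"
    and "\<forall>i\<in>{1..N}. continuous_on UNIV (inf_deriv (f i)) \<and> (\<forall>x. 0 < inf_deriv (f i) x)"
  shows "apply_bcontfun (transfer_op N f \<sigma> g) x =
    (\<Sum>i = 1..N. inf_deriv (f i) x powr \<sigma> * apply_bcontfun g (f i x))"
proof -
  let ?h = "\<lambda>x. \<Sum>i = 1..N. inf_deriv (f i) x powr \<sigma> * apply_bcontfun g (f i x)"
  have g: "continuous_on UNIV (apply_bcontfun g)"
    using apply_bcontfun[of g] by (simp add: bcontfun_def)
  have "continuous_on UNIV (\<lambda>x. inf_deriv (f i) x powr \<sigma> * apply_bcontfun g (f i x))"
    if i: "i \<in> {1..N}" for i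
  proof (intro continuous_on_mult continuous_on_powr continuous_on_const)
    show "continuous_on UNIV (\<lambda>x. inf_deriv (f i) x)"
      using assms(3) i by blast
    show "\<forall>x\<in>UNIV. inf_deriv (f i) x \<noteq> 0"
      using assms(3) i by (metis less_irrefl)
    show "continuous_on UNIV (\<lambda>x. apply_bcontfun g (f i x))"
      using continuous_on_compose2[OF g] assms(2) i by blast
  qed
  then have cont: "continuous_on UNIV ?h"
    by (intro continuous_on_sum) auto
  have "bounded (range ?h)"
    using compact_continuous_image[OF cont assms(1)] by (rule compact_imp_bounded)
  with cont have "?h \<in> bcontfun"
    by (simp add: bcontfun_def)
  then show ?thesis
    by (simp add: transfer_op_def Bcontfun_inverse)
qed

lemma bounded_linear_transfer_op:
  fixes f :: "nat \<Rightarrow> 'a::metric_space \<Rightarrow> 'a"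
  assumes "compact (UNIV :: 'a set)"
    and "\<forall>i\<in>{1..N}. continuous_on UNIV (f i)"
    and "\<forall>i\<in>{1..N}. continuous_on UNIV (inf_deriv (f i)) \<and> (\<forall>x. 0 < inf_deriv (f i) x)"
  shows "bounded_linear (transfer_op N f \<sigma>)"
proof -
  note ap = apply_transfer_op[OF assms]
  let ?one = "const_bcontfun 1 :: 'a \<Rightarrow>\<^sub>C real"
  have "norm (transfer_op N f \<sigma> g) \<le> norm g * norm (transfer_op N f \<sigma> ?one)" for g
  proof (rule norm_bound)
    fix x
    have "norm (apply_bcontfun (transfer_op N f \<sigma> g) x)
        \<le> (\<Sum>i = 1..N. inf_deriv (f i) x powr \<sigma> * norm g)"
      unfolding ap
    proof (rule sum_norm_le)
      fix i
      show "norm (inf_deriv (f i) x powr \<sigma> * apply_bcontfun g (f i x))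
          \<le> inf_deriv (f i) x powr \<sigma> * norm g"
        using norm_bounded[of g "f i x"] by (simp add: abs_mult mult_left_mono)
    qed
    also have "\<dots> = norm g * apply_bcontfun (transfer_op N f \<sigma> ?one) x"
      by (simp add: ap sum_distrib_left mult.commute)
    also have "\<dots> \<le> norm g * norm (transfer_op N f \<sigma> ?one)"
      using norm_bounded[of "transfer_op N f \<sigma> ?one" x] by (intro mult_left_mono) auto
    finally show "norm (apply_bcontfun (transfer_op N f \<sigma> g) x)
        \<le> norm g * norm (transfer_op N f \<sigma> ?one)" .
  qed
  then show ?thesis
    by (intro bounded_linear_intro[where K = "norm (transfer_op N f \<sigma> ?one)"] bcontfun_eqI)
      (auto simp: ap sum.distrib sum_distrib_left algebra_simps)
qed

text \<open>
  The spectrum of an operator \<open>T\<close> on a real normed space is that of its complexification.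
  The complexification is modelled by pairs, \<open>(u, v)\<close> standing for \<open>u + \<i> v\<close>, so that
  \<open>complex_resolvent_op T z\<close> is \<open>z I - T\<close>.  The product norm is equivalent to any of the usual
  complexification norms, and a real-linear inverse of \<open>z I - T\<close> is automatically complex-linear.
\<close>

definition complex_resolvent_op ::
    "('b::real_normed_vector \<Rightarrow> 'b) \<Rightarrow> complex \<Rightarrow> 'b \<times> 'b \<Rightarrow> 'b \<times> 'b" where
  "complex_resolvent_op T z = (\<lambda>(u, v).
     (Re z *\<^sub>R u - Im z *\<^sub>R v - T u, Re z *\<^sub>R v + Im z *\<^sub>R u - T v))"

definition op_spectrum :: "('b::real_normed_vector \<Rightarrow> 'b) \<Rightarrow> complex set" where
  "op_spectrum T = {z. \<not> (\<exists>S. bounded_linear S \<and>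
      S \<circ> complex_resolvent_op T z = id \<and> complex_resolvent_op T z \<circ> S = id)}"

definition op_spectral_radius :: "('b::real_normed_vector \<Rightarrow> 'b) \<Rightarrow> real" where
  "op_spectral_radius T = (SUP z\<in>op_spectrum T. cmod z)"

text \<open>
  In dimension \<open>0\<close> a nonempty set of diameter \<open>0\<close> counts \<open>1\<close> (whereas \<open>0 powr 0 = 0\<close>), and the
  empty set always counts \<open>0\<close>.  Covering sets have to be bounded because \<open>diameter\<close> is
  unspecified on unbounded sets.
\<close>

definition hausdorff_gauge :: "real \<Rightarrow> 'a::metric_space set \<Rightarrow> ennreal" where
  "hausdorff_gauge s C =
     (if C = {} then 0 else if s = 0 then 1 else ennreal (diameter C powr s))"

definition hausdorff_premeasure :: "real \<Rightarrow> real \<Rightarrow> 'a::metric_space set \<Rightarrow> ennreal" where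
  "hausdorff_premeasure s \<delta> A =
     Inf {\<Sum>n. hausdorff_gauge s (C n) | C :: nat \<Rightarrow> 'a set.
       A \<subseteq> (\<Union>n. C n) \<and> (\<forall>n. bounded (C n) \<and> diameter (C n) \<le> \<delta>)}"

definition hausdorff_measure :: "real \<Rightarrow> 'a::metric_space set \<Rightarrow> ennreal" where
  "hausdorff_measure s A = (SUP \<delta>\<in>{0<..}. hausdorff_premeasure s \<delta> A)"

definition hausdorff_dim :: "'a::metric_space set \<Rightarrow> ereal" where
  "hausdorff_dim A = Inf {ereal s | s. 0 \<le> s \<and> hausdorff_measure s A = 0}"

end

theory Submission
  imports Defs
begin

text \<open>
  By bounded distortion the partition sums \<open>Z\<^sub>n(\<sigma>) = \<Sum>|w|=n. (D f\<^sub>w)\<^sup>\<sigma>\<close> are almost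
  multiplicative in \<open>n\<close>, so \<open>Z\<^sub>n(\<sigma>) = exp (n P(\<sigma>))\<close> up to bounded factors.  Since
  \<open>L\<^sub>\<sigma>\<^sup>n 1 = Z\<^sub>n(\<sigma>)\<close>, the spectral radius is \<open>exp P(\<sigma>)\<close>, and \<open>P\<close> is continuous and
  strictly decreasing with \<open>P(0) = ln N \<ge> 0\<close>, so that it has exactly one zero \<open>\<sigma>\<^sub>0\<close>.
  On small scales \<open>f\<^sub>w\<close> is a similitude of ratio \<open>D f\<^sub>w\<close> up to a factor \<open>(1 \<plusminus> \<epsilon>)\<^sup>|\<^sup>w\<^sup>|\<close>,
  which does not matter away from \<open>\<sigma>\<^sub>0\<close>.  For \<open>s > \<sigma>\<^sub>0\<close> the cylinders of length \<open>n\<close> give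
  covers of arbitrarily small \<open>s\<close>-dimensional size.  For \<open>s < \<sigma>\<^sub>0\<close> the strong open set
  condition yields a finite subsystem with separated images whose ratios satisfy
  \<open>\<Sum>v. r\<^sub>v\<^sup>s \<ge> 1\<close>, and such a system forces positive \<open>s\<close>-dimensional measure.
\<close>

section \<open>Growth rates and spectral radius\<close>

text \<open>An infinitesimal similitude is controlled only in the limit at each point, so every
  estimate at a positive scale carries a factor \<open>1 \<plusminus> e\<close> per letter. This is
  an exponential loss and no constant absorbs it. At an exponent \<open>s\<close> other than
  \<open>\<sigma>\<^sub>0\<close>, however, the pressure has a definite sign, and \<open>e\<close>
  is chosen so that the loss uses up exactly half of it. The proof therefore works on the two sides
  of \<open>\<sigma>\<^sub>0\<close> and makes no claim about the measure at the critical exponent.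
  Everything is done with finite sums: the spectral radius comes from two-sided bounds of the
  partition sums, with the constant function 1 as test vector, and the lower bound for the measure
  from an induction over finite covers. A second obstacle is that the maps are injective only on
  \<open>A\<close> while the open set condition speaks of \<open>U\<close>, so images can be told
  apart only for points of \<open>A \<inter> U\<close>. One fixed word first moves \<open>A\<close>
  into \<open>U\<close>. It costs a constant factor, which a long block of further letters outweighs
  as soon as the pressure is positive.\<close>

lemma almost_additive_growth:
  fixes a :: "nat \<Rightarrow> real"
  assumes "\<And>m n. \<bar>a (m + n) - a m - a n\<bar> \<le> k"
  shows "\<exists>l. \<forall>n. \<bar>a n - real n * l\<bar> \<le> k"
proof -
  have k0: "k \<ge> 0"
    using assms[of 0 0] by linarith
  have mult: "\<bar>a (Suc n * m) - real (Suc n) * a m\<bar> \<le> real n * k" for m n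
  proof (induction n)
    case (Suc n)
    have "Suc (Suc n) * m = m + Suc n * m" by simp
    then have "\<bar>a (Suc (Suc n) * m) - a m - a (Suc n * m)\<bar> \<le> k"
      using assms by metis
    with Suc show ?case
      by (simp add: algebra_simps)
  qed simp
  \<comment> \<open>Both \<open>real n * a m\<close> and \<open>real m * a n\<close> approximate
    \<open>a (n * m)\<close>, with errors \<open>real n * k - k\<close> and
    \<open>real m * k - k\<close>. Hence every lower quotient stays below every upper one, and the
    supremum of the lower quotients separates the two families.\<close>
  have cmp: "(a m - k) / real m \<le> (a n + k) / real n" if "0 < m" "0 < n" for m n
  proof -
    have "\<bar>a (n * m) - real n * a m\<bar> \<le> real n * k - k"
      using mult[of "n - 1" m] that by (simp add: algebra_simps of_nat_diff)
    moreover have "\<bar>a (n * m) - real m * a n\<bar> \<le> real m * k - k"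
      using mult[of "m - 1" n] that by (simp add: algebra_simps of_nat_diff)
    ultimately have "real n * (a m - k) \<le> real m * (a n + k)"
      using k0 by (simp add: algebra_simps)
    then show ?thesis
      using that by (simp add: field_simps)
  qed
  define l where "l = (SUP m\<in>{0<..}. (a m - k) / real m)"
  have "bdd_above ((\<lambda>m. (a m - k) / real m) ` {0<..})"
    by (rule bdd_aboveI[where M = "(a 1 + k) / real 1"]) (use cmp[of _ 1] in auto)
  then have low: "(a n - k) / real n \<le> l" if "0 < n" for n
    unfolding l_def by (rule cSUP_upper2) (use that in auto)
  have up: "l \<le> (a n + k) / real n" if "0 < n" for n
    unfolding l_def by (rule cSUP_least) (use that cmp in auto)
  have "\<bar>a n - real n * l\<bar> \<le> k" for n
  proof (cases "n = 0")
    case True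
    then show ?thesis using assms[of 0 0] by simp
  next
    case False
    then show ?thesis
      using low[of n] up[of n] by (simp add: field_simps)
  qed
  then show ?thesis by blast
qed

section \<open>Complex scalars on pairs, the Neumann series and the spectral radius\<close>

definition complex_scale :: "complex \<Rightarrow> 'b::real_normed_vector \<times> 'b \<Rightarrow> 'b \<times> 'b" where
  "complex_scale z = (\<lambda>(u, v). (Re z *\<^sub>R u - Im z *\<^sub>R v, Re z *\<^sub>R v + Im z *\<^sub>R u))"

lemma complex_scale_mult: "complex_scale (z * w) p = complex_scale z (complex_scale w p)"
  by (simp add: complex_scale_def case_prod_unfold algebra_simps)

lemma complex_scale_1 [simp]: "complex_scale 1 p = p"
  by (simp add: complex_scale_def case_prod_unfold)

text \<open>The 4 is crude: each of four real products is at most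
  \<open>cmod z * norm p\<close>.\<close>

lemma norm_complex_scale_le: "norm (complex_scale z p) \<le> 4 * cmod z * norm p"
proof -
  obtain u v where p: "p = (u, v)" by fastforce
  have uv: "norm u \<le> norm p" "norm v \<le> norm p"
    using norm_fst_le[of u v] norm_snd_le[of v u] by (auto simp: p)
  have b: "\<bar>Re z\<bar> * norm x \<le> cmod z * norm p" "\<bar>Im z\<bar> * norm x \<le> cmod z * norm p"
    if "norm x \<le> norm p" for x :: 'a
    using that abs_Re_le_cmod abs_Im_le_cmod by (auto intro!: mult_mono)
  have "norm (complex_scale z p) \<le>
      norm (Re z *\<^sub>R u - Im z *\<^sub>R v) + norm (Re z *\<^sub>R v + Im z *\<^sub>R u)"
    by (simp add: p complex_scale_def norm_Pair_le)
  also have "\<dots> \<le> (\<bar>Re z\<bar> * norm u + \<bar>Im z\<bar> * norm v) + (\<bar>Re z\<bar> * norm v + \<bar>Im z\<bar> * norm u)"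
    by (intro add_mono norm_triangle_le_diff norm_triangle_le) auto
  also have "\<dots> \<le> 4 * cmod z * norm p"
    using b[OF uv(1)] b[OF uv(2)] by linarith
  finally show ?thesis .
qed

lemma bounded_linear_complex_scale: "bounded_linear (complex_scale z)"
proof (rule bounded_linear_intro[where K = "4 * cmod z"])
  show "norm (complex_scale z p) \<le> norm p * (4 * cmod z)" for p :: "'a \<times> 'a"
    using norm_complex_scale_le[of z p] by (simp add: mult.commute)
qed (auto simp: complex_scale_def case_prod_unfold algebra_simps)

lemma complex_resolvent_op_eq:
  "complex_resolvent_op T z p = complex_scale z p - map_prod T T p"
  by (simp add: complex_resolvent_op_def complex_scale_def case_prod_unfold map_prod_def)

lemma bounded_linear_map_prod:
  assumes "bounded_linear T"
  shows "bounded_linear (map_prod T T)"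
  using bounded_linear_Pair[OF bounded_linear_compose[OF assms bounded_linear_fst]
      bounded_linear_compose[OF assms bounded_linear_snd]]
  by (simp add: map_prod_def case_prod_unfold)

lemma bounded_linear_funpow:
  assumes "bounded_linear (T :: 'b::real_normed_vector \<Rightarrow> 'b)"
  shows "bounded_linear (T ^^ n)"
proof (induction n)
  case 0
  then show ?case by (simp add: id_def bounded_linear_ident)
next
  case (Suc n)
  then show ?case
    using bounded_linear_compose[OF assms] by (simp add: o_def)
qed

text \<open>Neumann series: the inverse of \<open>z - T\<close> is the sum of
  \<open>w ^ Suc n\<close> times \<open>T ^^ n\<close> with \<open>w = 1 / z\<close>. The growth of
  the powers, rather than the norm of \<open>T\<close>, makes its terms decay like the powers of
  \<open>q = \<rho> * cmod w < 1\<close>.\<close>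

lemma not_in_op_spectrum:
  fixes T :: "'b::banach \<Rightarrow> 'b"
  assumes T: "bounded_linear T"
    and growth: "\<And>n x. norm ((T ^^ n) x) \<le> K * \<rho> ^ n * norm x"
    and "0 < \<rho>" and z: "\<rho> < cmod z"
  shows "z \<notin> op_spectrum T"
proof -
  define w where "w = inverse z"
  define q where "q = \<rho> * cmod w"
  define M where "M n = map_prod (T ^^ n) (T ^^ n)" for n
  define t where "t n p = complex_scale (w ^ Suc n) (M n p)" for n p
  define b where "b n p = complex_scale (w ^ n) (M n p)" for n p
  let ?R = "complex_resolvent_op T z"
  have zw: "z * w = 1"
    using z \<open>0 < \<rho>\<close> by (cases "z = 0") (auto simp: w_def)
  have w0: "cmod w > 0" using zw by auto
  have q: "0 < q" "q < 1"
    using z \<open>0 < \<rho>\<close> w0 by (auto simp: q_def w_def norm_inverse norm_divide field_simps)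
  \<comment> \<open>A negative \<open>K\<close> is compatible with the growth bound only on the zero
    space, as the case \<open>n = 0\<close> shows.\<close>
  have K: "K \<ge> 0" if "norm (p :: 'b \<times> 'b) > 0" for p
  proof (rule ccontr)
    assume "\<not> K \<ge> 0"
    then have "norm x = 0" for x :: 'b
      using growth[of 0 x] by (cases "norm x = 0") (auto simp: mult_less_0_iff dest: order_trans[OF norm_ge_zero])
    then have "p = 0" by (intro prod_eqI) auto
    with that show False by simp
  qed
  have normM: "norm (M n p) \<le> 2 * K * \<rho> ^ n * norm p" for n p
  proof (cases "p = 0")
    case True
    have "bounded_linear (M n)"
      by (simp add: M_def bounded_linear_map_prod bounded_linear_funpow T)
    with True show ?thesis by (simp add: linear_simps)
  next
    case False
    then have K0: "K \<ge> 0" using K by simp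
    obtain u v where p: "p = (u, v)" by fastforce
    have "norm (M n p) \<le> norm ((T ^^ n) u) + norm ((T ^^ n) v)"
      by (simp add: M_def p norm_Pair_le)
    also have "\<dots> \<le> K * \<rho> ^ n * norm u + K * \<rho> ^ n * norm v"
      by (intro add_mono growth)
    also have "\<dots> \<le> K * \<rho> ^ n * norm p + K * \<rho> ^ n * norm p"
      using norm_fst_le[of u v] norm_snd_le[of v u] \<open>0 < \<rho>\<close> K0
      by (intro add_mono mult_left_mono) (auto simp: p)
    finally show ?thesis by (simp add: mult_ac)
  qed
  have normb: "norm (b n p) \<le> 8 * K * norm p * q ^ n" for n p
  proof -
    have "norm (b n p) \<le> 4 * cmod (w ^ n) * norm (M n p)"
      unfolding b_def by (rule norm_complex_scale_le)
    also have "\<dots> \<le> 4 * cmod (w ^ n) * (2 * K * \<rho> ^ n * norm p)"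
      by (intro mult_left_mono normM) auto
    also have "\<dots> = 8 * K * norm p * q ^ n"
      by (simp add: q_def norm_power power_mult_distrib)
    finally show ?thesis .
  qed
  have tb: "t n p = complex_scale w (b n p)" for n p
    by (simp add: t_def b_def complex_scale_mult)
  have normt: "norm (t n p) \<le> 32 * cmod w * K * norm p * q ^ n" for n p
    using order_trans[OF norm_complex_scale_le, of w "b n p"] normb[of n p] w0
    unfolding tb by (fastforce simp: algebra_simps intro: mult_left_mono)
  have summ_bound: "summable (\<lambda>n. C * q ^ n)" for C
    using q by (intro summable_mult summable_geometric) auto
  have summ_norm: "summable (\<lambda>n. norm (t n p))" for p
    by (rule summable_comparison_test'[OF summ_bound, where N = 0]) (simp, rule normt)
  then have summ: "summable (\<lambda>n. t n p)" for p
    by (rule summable_norm_cancel)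
  have M_lin: "bounded_linear (M n)" for n
    by (simp add: M_def bounded_linear_map_prod bounded_linear_funpow T)
  have t_lin: "bounded_linear (t n)" for n
    unfolding t_def by (rule bounded_linear_compose[OF bounded_linear_complex_scale M_lin])
  have R_lin: "bounded_linear ?R"
    using bounded_linear_sub[OF bounded_linear_complex_scale bounded_linear_map_prod[OF T]]
    by (simp add: complex_resolvent_op_eq[abs_def])
  define S where "S p = (\<Sum>n. t n p)" for p
  have S_lin: "bounded_linear S"
  proof (rule bounded_linear_intro)
    show "S (p + p') = S p + S p'" for p p'
      unfolding S_def using t_lin by (simp add: linear_simps suminf_add summ)
    show "S (r *\<^sub>R p) = r *\<^sub>R S p" for r p
      unfolding S_def using t_lin by (simp add: linear_simps suminf_scaleR_right summ)
    show "norm (S p) \<le> norm p * (32 * cmod w * K * (\<Sum>n. q ^ n))" for p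
    proof -
      have "norm (S p) \<le> (\<Sum>n. norm (t n p))"
        unfolding S_def by (rule summable_norm[OF summ_norm])
      also have "\<dots> \<le> (\<Sum>n. 32 * cmod w * K * norm p * q ^ n)"
        by (rule suminf_le[OF normt summ_norm summ_bound])
      also have "\<dots> = 32 * cmod w * K * norm p * (\<Sum>n. q ^ n)"
        using q by (intro suminf_mult summable_geometric) auto
      finally show ?thesis by (simp add: algebra_simps)
    qed
  qed
  have M_Suc: "map_prod T T (M n p) = M (Suc n) p" "M n (map_prod T T p) = M (Suc n) p" for n p
    by (simp_all add: M_def case_prod_unfold map_prod_def funpow_swap1)
  have comm: "complex_scale x (map_prod T T p) = map_prod T T (complex_scale x p)"
      "complex_scale x (M n p) = M n (complex_scale x p)" for x n p
    using T bounded_linear_funpow[OF T]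
    by (simp_all add: complex_scale_def M_def case_prod_unfold map_prod_def linear_simps)
  \<comment> \<open>One factor \<open>z\<close> cancels against \<open>w\<close> and one application
    of \<open>T\<close> raises the power, so the resolvent turns the series into a telescoping
    one.\<close>
  have Rt: "?R (t n p) = b n p - b (Suc n) p" for n p
  proof -
    have "z * w ^ Suc n = w ^ n" using zw by (simp add: mult.assoc[symmetric])
    then show ?thesis
      by (simp add: complex_resolvent_op_eq t_def b_def complex_scale_mult[symmetric]
          comm(1)[symmetric] M_Suc del: power_Suc)
  qed
  \<comment> \<open>Scalars and powers of \<open>T\<close> commute with the resolvent, so the same
    telescoping sum gives the left and the right inverse.\<close>
  have tR: "t n (?R p) = ?R (t n p)" for n p
  proof -
    have "t n (?R p) = complex_scale (w ^ Suc n) (M n (complex_scale z p))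
        - complex_scale (w ^ Suc n) (M n (map_prod T T p))"
      by (simp only: t_def complex_resolvent_op_eq linear_simps(2)[OF M_lin]
          linear_simps(2)[OF bounded_linear_complex_scale])
    also have "M n (complex_scale z p) = complex_scale z (M n p)"
      by (simp add: comm)
    also have "complex_scale (w ^ Suc n) (complex_scale z (M n p)) = complex_scale z (t n p)"
      by (simp add: t_def complex_scale_mult[symmetric] mult.commute)
    also have "M n (map_prod T T p) = map_prod T T (M n p)"
      by (simp add: M_Suc)
    finally show ?thesis
      by (simp add: complex_resolvent_op_eq t_def comm(1))
  qed
  have "(\<lambda>n. b n p) \<longlonglongrightarrow> 0" for p
    by (rule Lim_null_comparison[OF _ summable_LIMSEQ_zero[OF summ_bound]])
      (rule eventuallyI, rule normb)
  then have "(\<lambda>n. b n p - b (Suc n) p) sums (b 0 p - 0)" for p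
    by (rule telescope_sums')
  then have Rt_sums: "(\<lambda>n. ?R (t n p)) sums p" for p
    by (simp add: Rt b_def M_def map_prod_def case_prod_unfold)
  have "S (?R p) = p" for p
    using sums_unique[OF Rt_sums[of p]] by (simp add: S_def tR)
  moreover have "?R (S p) = p" for p
    using sums_unique[OF Rt_sums[of p]] bounded_linear.suminf[OF R_lin summ[of p]]
    by (simp add: S_def)
  ultimately show ?thesis
    using S_lin by (auto simp: op_spectrum_def fun_eq_iff)
qed

text \<open>
  The averages \<open>v\<^sub>n = \<Sum>k<n. T\<^sup>k e / \<rho>\<^sup>k\<close> grow linearly, but \<open>(\<rho> - T) v\<^sub>n\<close> telescopes
  and stays bounded, so \<open>\<rho> - T\<close> has no bounded inverse.
\<close>

lemma in_op_spectrum: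
  fixes T :: "'b::real_normed_vector \<Rightarrow> 'b"
  assumes T: "bounded_linear T"
    and growth: "\<And>n. norm ((T ^^ n) e) \<le> K * \<rho> ^ n"
    and "0 < \<rho>" and "0 < \<kappa>"
    and average: "\<And>n. \<kappa> * real n \<le> norm (\<Sum>k<n. (1 / \<rho> ^ k) *\<^sub>R (T ^^ k) e)"
  shows "complex_of_real \<rho> \<in> op_spectrum T"
proof (rule ccontr)
  let ?R = "complex_resolvent_op T (complex_of_real \<rho>)"
  assume "complex_of_real \<rho> \<notin> op_spectrum T"
  then obtain S where S: "bounded_linear S" and SR: "S \<circ> ?R = id"
    by (auto simp: op_spectrum_def)
  obtain B where B: "\<And>p. norm (S p) \<le> norm p * B" "B \<ge> 0"
    using bounded_linear.nonneg_bounded[OF S] by blast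
  define v where "v n = (\<Sum>k<n. (1 / \<rho> ^ k) *\<^sub>R (T ^^ k) e)" for n
  have Tv: "\<rho> *\<^sub>R v n - T (v n) = \<rho> *\<^sub>R (e - (1 / \<rho> ^ n) *\<^sub>R (T ^^ n) e)" for n
  proof (induction n)
    case 0
    then show ?case using T by (simp add: v_def linear_simps)
  next
    case (Suc n)
    have "v (Suc n) = v n + (1 / \<rho> ^ n) *\<^sub>R (T ^^ n) e"
      by (simp add: v_def)
    then have "\<rho> *\<^sub>R v (Suc n) - T (v (Suc n)) = (\<rho> *\<^sub>R v n - T (v n))
        + \<rho> *\<^sub>R (1 / \<rho> ^ n) *\<^sub>R (T ^^ n) e - (1 / \<rho> ^ n) *\<^sub>R (T ^^ Suc n) e"
      using T by (simp add: linear_simps algebra_simps)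
    also have "\<dots> = \<rho> *\<^sub>R e - (1 / \<rho> ^ n) *\<^sub>R (T ^^ Suc n) e"
      unfolding Suc by (simp add: algebra_simps)
    also have "\<dots> = \<rho> *\<^sub>R (e - (1 / \<rho> ^ Suc n) *\<^sub>R (T ^^ Suc n) e)"
      using \<open>0 < \<rho>\<close> by (simp add: algebra_simps)
    finally show ?case .
  qed
  have bound: "\<kappa> * real n \<le> \<rho> * (norm e + K) * B" for n
  proof -
    have "norm ((1 / \<rho> ^ n) *\<^sub>R (T ^^ n) e) \<le> K"
      using growth[of n] \<open>0 < \<rho>\<close> by (simp add: field_simps)
    then have "norm (e - (1 / \<rho> ^ n) *\<^sub>R (T ^^ n) e) \<le> norm e + K"
      using norm_triangle_ineq4[of e "(1 / \<rho> ^ n) *\<^sub>R (T ^^ n) e"] by linarith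
    then have R: "norm (\<rho> *\<^sub>R v n - T (v n)) \<le> \<rho> * (norm e + K)"
      using \<open>0 < \<rho>\<close> by (simp add: Tv)
    \<comment> \<open>Since \<open>\<rho>\<close> is real, the resolvent keeps the imaginary part 0
      and acts on the real part as \<open>\<rho> - T\<close>; the real estimate \<open>Tv\<close>
      suffices.\<close>
    have "\<kappa> * real n \<le> norm (v n, 0 :: 'b)"
      using average[of n] by (simp add: v_def norm_Pair)
    also have "\<dots> = norm (S (?R (v n, 0)))"
      using SR by (metis comp_apply id_apply)
    also have "\<dots> \<le> norm (?R (v n, 0)) * B"
      by (rule B)
    also have "norm (?R (v n, 0)) = norm (\<rho> *\<^sub>R v n - T (v n))"
      using T by (simp add: complex_resolvent_op_def norm_Pair linear_simps)
    finally show ?thesis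
      using R B(2) by (meson mult_right_mono order_trans)
  qed
  obtain n where "\<rho> * (norm e + K) * B / \<kappa> < real n"
    using reals_Archimedean2 by blast
  with bound[of n] \<open>0 < \<kappa>\<close> show False
    by (simp add: field_simps)
qed

text \<open>The supremum is attained at \<open>\<rho>\<close>: the linear growth of the averages of
  \<open>e\<close> puts \<open>\<rho>\<close> into the spectrum, and the growth bound excludes every
  point of larger modulus.\<close>

lemma op_spectral_radius_eqI:
  fixes T :: "'b::banach \<Rightarrow> 'b"
  assumes "bounded_linear T"
    and growth: "\<And>n x. norm ((T ^^ n) x) \<le> K * \<rho> ^ n * norm x"
    and "0 < \<rho>" and "0 < \<kappa>"
    and "\<And>n. \<kappa> * real n \<le> norm (\<Sum>k<n. (1 / \<rho> ^ k) *\<^sub>R (T ^^ k) e)"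
  shows "op_spectral_radius T = \<rho>"
  unfolding op_spectral_radius_def
proof (rule cSup_eq_maximum)
  have "complex_of_real \<rho> \<in> op_spectrum T"
    using growth[of _ e]
    by (intro in_op_spectrum[where K = "K * norm e" and e = e, OF assms(1) _ assms(3,4,5)])
      (simp add: mult_ac)
  then show "\<rho> \<in> cmod ` op_spectrum T"
    using \<open>0 < \<rho>\<close> by (force simp: image_iff)
  show "x \<le> \<rho>" if "x \<in> cmod ` op_spectrum T" for x
    using that not_in_op_spectrum[OF assms(1) growth \<open>0 < \<rho>\<close>] by force
qed

section \<open>Estimates of the Hausdorff measure\<close>

lemma diameter_leI:
  fixes S :: "'a::metric_space set"
  assumes "0 \<le> d" and "\<And>x y. x \<in> S \<Longrightarrow> y \<in> S \<Longrightarrow> dist x y \<le> d"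
  shows "diameter S \<le> d"
  using assms by (auto simp: diameter_def intro!: cSUP_least)

text \<open>Padding a finite cover with empty sets costs nothing because their gauge is 0. The index
  type is left free so that words can serve as indices.\<close>

lemma hausdorff_measure_eq_0I:
  fixes A :: "'a::metric_space set"
  assumes "0 < s"
    and cover: "\<And>\<delta> \<eta>. 0 < \<delta> \<Longrightarrow> 0 < \<eta> \<Longrightarrow> \<exists>(I :: 'i set) C. finite I \<and> A \<subseteq> (\<Union>i\<in>I. C i) \<and>
      (\<forall>i\<in>I. bounded (C i) \<and> diameter (C i) \<le> \<delta>) \<and> (\<Sum>i\<in>I. diameter (C i) powr s) \<le> \<eta>"
  shows "hausdorff_measure s A = 0"
proof -
  have "hausdorff_premeasure s \<delta> A \<le> 0 + ennreal \<eta>" if pos: "0 < \<delta>" "0 < \<eta>" for \<delta> \<eta>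
  proof -
    obtain I :: "'i set" and C where I: "finite I" "A \<subseteq> (\<Union>i\<in>I. C i)"
      "\<And>i. i \<in> I \<Longrightarrow> bounded (C i) \<and> diameter (C i) \<le> \<delta>" "(\<Sum>i\<in>I. diameter (C i) powr s) \<le> \<eta>"
      using cover[OF pos] by blast
    obtain h where h: "bij_betw h {0..<card I} I"
      using ex_bij_betw_nat_finite[OF I(1)] by blast
    define V where "V n = (if n < card I then C (h n) else {})" for n
    have hI: "h n \<in> I" if "n < card I" for n
      using h that by (auto simp: bij_betw_def)
    have "A \<subseteq> (\<Union>n. V n)"
    proof
      fix x assume "x \<in> A"
      then obtain i where i: "i \<in> I" "x \<in> C i" using I(2) by blast
      then have "i \<in> h ` {0..<card I}"
        using h by (simp add: bij_betw_def)
      then obtain n where "n < card I" "h n = i"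
        by auto
      with i show "x \<in> (\<Union>n. V n)" by (auto simp: V_def)
    qed
    moreover have "bounded (V n) \<and> diameter (V n) \<le> \<delta>" for n
      using I(3)[OF hI[of n]] \<open>0 < \<delta>\<close> by (auto simp: V_def)
    ultimately have "hausdorff_premeasure s \<delta> A \<le> (\<Sum>n. hausdorff_gauge s (V n))"
      unfolding hausdorff_premeasure_def by (intro Inf_lower) auto
    also have "\<dots> = (\<Sum>n\<in>{0..<card I}. hausdorff_gauge s (V n))"
      by (rule suminf_finite) (auto simp: V_def hausdorff_gauge_def)
    also have "\<dots> = (\<Sum>i\<in>I. hausdorff_gauge s (C i))"
      using sum.reindex_bij_betw[OF h, of "\<lambda>i. hausdorff_gauge s (C i)"]
      by (simp add: V_def)
    also have "\<dots> \<le> (\<Sum>i\<in>I. ennreal (diameter (C i) powr s))"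
      using \<open>0 < s\<close> by (intro sum_mono) (simp add: hausdorff_gauge_def)
    also have "\<dots> = ennreal (\<Sum>i\<in>I. diameter (C i) powr s)"
      by (simp add: sum_ennreal)
    also have "\<dots> \<le> 0 + ennreal \<eta>"
      using I(4) by (simp add: ennreal_leI)
    finally show ?thesis .
  qed
  then have "hausdorff_premeasure s \<delta> A \<le> 0" if "0 < \<delta>" for \<delta>
    by (rule ennreal_le_epsilon) (rule that)
  then have "hausdorff_measure s A \<le> 0"
    unfolding hausdorff_measure_def by (intro SUP_least) auto
  then show ?thesis by simp
qed

text \<open>Compactness reduces countable covers to finite ones: each member is thickened to an open
  set at an extra cost of \<open>e / 2 ^ Suc n\<close>, altogether at most \<open>e\<close>. The
  finite covers are tested without a limit on their diameters, so the bound is the same for every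
  \<open>\<delta>\<close>.\<close>

lemma hausdorff_premeasure_ge:
  fixes A :: "'a::metric_space set"
  assumes "compact A" and "0 < s"
    and ge: "\<And>(U :: nat \<Rightarrow> 'a set) J. finite J \<Longrightarrow> A \<subseteq> (\<Union>j\<in>J. U j) \<Longrightarrow> \<forall>j\<in>J. bounded (U j) \<Longrightarrow>
      \<eta> \<le> (\<Sum>j\<in>J. diameter (U j) powr s)"
  shows "ennreal \<eta> \<le> hausdorff_premeasure s \<delta> A"
  unfolding hausdorff_premeasure_def
proof (rule Inf_greatest, clarify)
  fix C :: "nat \<Rightarrow> 'a set"
  assume A: "A \<subseteq> (\<Union>n. C n)" and C: "\<forall>n. bounded (C n) \<and> diameter (C n) \<le> \<delta>"
  show "ennreal \<eta> \<le> (\<Sum>n. hausdorff_gauge s (C n))"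
  proof (rule ennreal_le_epsilon)
    fix e :: real assume "0 < e"
    \<comment> \<open>As \<open>s\<close> is positive, \<open>t powr s\<close> tends to 0 with
      \<open>t\<close>, so even a set of diameter 0 can be thickened cheaply.\<close>
    have "\<exists>d>0. (diameter (C n) + 2 * d) powr s \<le> diameter (C n) powr s + e / 2 ^ Suc n" for n
    proof -
      have "((\<lambda>d. (diameter (C n) + 2 * d) powr s) \<longlongrightarrow> (diameter (C n) + 2 * 0) powr s) (at_right 0)"
      proof (rule tendsto_powr2)
        show "((\<lambda>d. diameter (C n) + 2 * d) \<longlongrightarrow> diameter (C n) + 2 * 0) (at_right 0)"
          by (intro tendsto_intros)
        have "diameter (C n) \<ge> 0" using C diameter_ge_0 by blast
        then show "\<forall>\<^sub>F d in at_right 0. 0 \<le> diameter (C n) + 2 * d"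
          by (auto simp: eventually_at_right_field intro!: exI[of _ 1])
      qed (use \<open>0 < s\<close> in auto)
      then have "\<forall>\<^sub>F d in at_right 0. (diameter (C n) + 2 * d) powr s
          < diameter (C n) powr s + e / 2 ^ Suc n"
        using \<open>0 < e\<close> by (intro order_tendstoD(2)) auto
      moreover have "\<forall>\<^sub>F d in at_right (0::real). 0 < d"
        by (rule eventually_at_right_less)
      ultimately have "\<forall>\<^sub>F d in at_right 0. 0 < d \<and> (diameter (C n) + 2 * d) powr s
          \<le> diameter (C n) powr s + e / 2 ^ Suc n"
        by eventually_elim auto
      then show ?thesis
        using eventually_happens'[OF trivial_limit_at_right_real] by blast
    qed
    then have "\<exists>d. \<forall>n. 0 < d n \<and>
        (diameter (C n) + 2 * d n) powr s \<le> diameter (C n) powr s + e / 2 ^ Suc n"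
      by - (rule choice, rule allI)
    then obtain d where d: "\<And>n. 0 < d n"
      "\<And>n. (diameter (C n) + 2 * d n) powr s \<le> diameter (C n) powr s + e / 2 ^ Suc n"
      by blast
    define V where "V n = (\<Union>x\<in>C n. ball x (d n))" for n
    have "C n \<subseteq> V n" for n
    proof
      fix x assume "x \<in> C n"
      moreover have "x \<in> ball x (d n)" using d(1) by simp
      ultimately show "x \<in> V n" unfolding V_def by blast
    qed
    then have "(\<Union>n. C n) \<subseteq> (\<Union>n. V n)"
      by (rule UN_mono[OF subset_refl])
    with A have "A \<subseteq> (\<Union>n. V n)"
      by (rule order_trans)
    moreover have "open (V n)" for n
      by (auto simp: V_def)
    ultimately obtain J where J: "finite J" "A \<subseteq> (\<Union>n\<in>J. V n)"
      using compactE_image[OF \<open>compact A\<close>, of UNIV V] by auto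
    have dist_V: "dist x y \<le> diameter (C n) + 2 * d n" if xy: "x \<in> V n" "y \<in> V n" for x y n
    proof -
      obtain a b where "a \<in> C n" "dist a x < d n" "b \<in> C n" "dist b y < d n"
        using xy by (auto simp: V_def)
      moreover from this have "dist a b \<le> diameter (C n)"
        using C diameter_bounded_bound by blast
      moreover have "dist x y \<le> dist a x + dist a b + dist b y"
        using dist_triangle[of x y a] dist_triangle[of a y b] by (simp add: dist_commute)
      ultimately show ?thesis by linarith
    qed
    have "bounded (V n)" for n
      using dist_V unfolding bounded_two_points by blast
    then have "\<eta> \<le> (\<Sum>j\<in>J. diameter (V j) powr s)"
      using J by (intro ge) auto
    then have "ennreal \<eta> \<le> (\<Sum>j\<in>J. ennreal (diameter (V j) powr s))"
      by (simp add: sum_ennreal ennreal_leI)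
    also have "\<dots> \<le> (\<Sum>j\<in>J. hausdorff_gauge s (C j) + ennreal (e / 2 ^ Suc j))"
    proof (rule sum_mono)
      fix j
      show "ennreal (diameter (V j) powr s) \<le> hausdorff_gauge s (C j) + ennreal (e / 2 ^ Suc j)"
      proof (cases "C j = {}")
        case True
        then show ?thesis by (simp add: V_def)
      next
        case False
        have "0 \<le> diameter (C j)" using C diameter_ge_0 by blast
        then have "diameter (V j) \<le> diameter (C j) + 2 * d j"
          using dist_V d(1)[of j] by (intro diameter_leI) auto
        moreover have "0 \<le> diameter (V j)"
          using \<open>bounded (V j)\<close> by (rule diameter_ge_0)
        ultimately have "diameter (V j) powr s \<le> diameter (C j) powr s + e / 2 ^ Suc j"
          using powr_mono2[of s] \<open>0 < s\<close> d(2)[of j] by (meson less_imp_le order_trans)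
        then have "ennreal (diameter (V j) powr s) \<le> ennreal (diameter (C j) powr s + e / 2 ^ Suc j)"
          by (rule ennreal_leI)
        then show ?thesis
          using False \<open>0 < s\<close> \<open>0 < e\<close> by (simp add: hausdorff_gauge_def ennreal_plus)
      qed
    qed
    also have "\<dots> = (\<Sum>j\<in>J. hausdorff_gauge s (C j)) + (\<Sum>j\<in>J. ennreal (e / 2 ^ Suc j))"
      by (rule sum.distrib)
    also have "\<dots> \<le> (\<Sum>n. hausdorff_gauge s (C n)) + ennreal e"
    proof (rule add_mono)
      show "(\<Sum>j\<in>J. hausdorff_gauge s (C j)) \<le> (\<Sum>n. hausdorff_gauge s (C n))"
        by (intro sum_le_suminf J) auto
      have "(\<Sum>j\<in>J. ennreal (e / 2 ^ Suc j)) = ennreal (\<Sum>j\<in>J. e * (1 / 2) ^ Suc j)"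
        using \<open>0 < e\<close> by (subst sum_ennreal[symmetric]) (auto simp: power_one_over)
      also have "(\<Sum>j\<in>J. e * (1 / 2) ^ Suc j) \<le> e"
        using sum_le_suminf[OF sums_summable[OF sums_mult[OF power_half_series, of e]] J(1)]
          sums_unique[OF sums_mult[OF power_half_series, of e]] \<open>0 < e\<close> by simp
      finally show "(\<Sum>j\<in>J. ennreal (e / 2 ^ Suc j)) \<le> ennreal e"
        by (simp add: ennreal_leI)
    qed
    finally show "ennreal \<eta> \<le> (\<Sum>n. hausdorff_gauge s (C n)) + ennreal e" .
  qed
qed

text \<open>
  This replaces the mass distribution principle.  A cover by sets smaller than the gap
  \<open>\<Delta>\<close> splits into covers of the separated pieces; pulling these back along the \<open>g \<tau>\<close> gives
  covers of \<open>A\<close> with fewer members.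
\<close>

lemma finite_cover_diameter_sum:
  fixes g :: "'i \<Rightarrow> 'a::metric_space \<Rightarrow> 'a" and U :: "'j \<Rightarrow> 'a set"
  assumes T: "finite T" "2 \<le> card T" and "A \<noteq> {}" and "0 < s" and "0 < \<Delta>"
    and inv: "\<And>\<tau> u. \<tau> \<in> T \<Longrightarrow> u \<in> A \<Longrightarrow> g \<tau> u \<in> A"
    and sep: "\<And>\<tau> \<tau>' u v. \<tau> \<in> T \<Longrightarrow> \<tau>' \<in> T \<Longrightarrow> \<tau> \<noteq> \<tau>' \<Longrightarrow> u \<in> A \<Longrightarrow> v \<in> A \<Longrightarrow> \<Delta> \<le> dist (g \<tau> u) (g \<tau>' v)"
    and r: "\<And>\<tau>. \<tau> \<in> T \<Longrightarrow> 0 < r \<tau>"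
    and low: "\<And>\<tau> u v. \<tau> \<in> T \<Longrightarrow> u \<in> A \<Longrightarrow> v \<in> A \<Longrightarrow> r \<tau> * dist u v \<le> dist (g \<tau> u) (g \<tau> v)"
    and sum_r: "1 \<le> (\<Sum>\<tau>\<in>T. r \<tau> powr s)"
  shows "finite J \<Longrightarrow> A \<subseteq> (\<Union>j\<in>J. U j) \<Longrightarrow> \<forall>j\<in>J. bounded (U j) \<Longrightarrow>
    \<Delta> powr s \<le> (\<Sum>j\<in>J. diameter (U j) powr s)"
proof (induction "card J" arbitrary: J U rule: less_induct)
  case less
  show ?case
  \<comment> \<open>One large member pays the whole bound by itself. If there is none, no member can
    meet two pieces.\<close>
  proof (cases "\<exists>j\<in>J. \<Delta> \<le> diameter (U j)")
    case True
    then obtain j where j: "j \<in> J" "\<Delta> \<le> diameter (U j)" by blast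
    have "\<Delta> powr s \<le> diameter (U j) powr s"
      using j \<open>0 < s\<close> \<open>0 < \<Delta>\<close> by (intro powr_mono2) auto
    also have "\<dots> \<le> (\<Sum>j\<in>J. diameter (U j) powr s)"
      using j less.prems by (intro member_le_sum) auto
    finally show ?thesis .
  next
    case False
    define I where "I \<tau> = {j \<in> J. U j \<inter> g \<tau> ` A \<noteq> {}}" for \<tau>
    have I_fin: "finite (I \<tau>)" for \<tau>
      using less.prems(1) by (simp add: I_def)
    have disj: "I \<tau> \<inter> I \<tau>' = {}" if \<tau>: "\<tau> \<in> T" "\<tau>' \<in> T" "\<tau> \<noteq> \<tau>'" for \<tau> \<tau>'
    proof (rule ccontr)
      assume "I \<tau> \<inter> I \<tau>' \<noteq> {}"
      then obtain j u v where j: "j \<in> J" "u \<in> A" "v \<in> A" "g \<tau> u \<in> U j" "g \<tau>' v \<in> U j"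
        by (auto simp: I_def)
      then have "dist (g \<tau> u) (g \<tau>' v) \<le> diameter (U j)"
        using less.prems(3) diameter_bounded_bound by blast
      with sep[OF \<tau> j(2,3)] False j(1) show False by force
    qed
    have nonempty: "I \<tau> \<noteq> {}" if "\<tau> \<in> T" for \<tau>
    proof -
      obtain u where "u \<in> A" using \<open>A \<noteq> {}\<close> by blast
      moreover from this inv that less.prems(2) have "g \<tau> u \<in> (\<Union>j\<in>J. U j)" by blast
      ultimately show ?thesis by (auto simp: I_def)
    qed
    have piece: "r \<tau> powr s * \<Delta> powr s \<le> (\<Sum>j\<in>I \<tau>. diameter (U j) powr s)" if \<tau>: "\<tau> \<in> T" for \<tau>
    proof -
      define V where "V j = {u \<in> A. g \<tau> u \<in> U j}" for j
      \<comment> \<open>A second piece exists because \<open>2 \<le> card T\<close>. Some member of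
        the cover meets it and hence misses the present piece, so fewer members cover this one and
        the induction applies.\<close>
      have "\<exists>\<tau>'\<in>T. \<tau>' \<noteq> \<tau>"
      proof (rule ccontr)
        assume "\<not> ?thesis"
        then have "T \<subseteq> {\<tau>}" by blast
        with T show False using card_mono[of "{\<tau>}" T] by simp
      qed
      then obtain \<tau>' where \<tau>': "\<tau>' \<in> T" "\<tau>' \<noteq> \<tau>" by blast
      obtain i where "i \<in> I \<tau>'"
        using nonempty[OF \<tau>'(1)] by blast
      then have "i \<notin> I \<tau>" "i \<in> J"
        using disj[OF \<tau> \<tau>'(1)] \<tau>'(2) by (auto simp: I_def)
      then have "I \<tau> \<subset> J"
        by (auto simp: I_def)
      then have "card (I \<tau>) < card J"
        by (intro psubset_card_mono less.prems)
      moreover have "A \<subseteq> (\<Union>j\<in>I \<tau>. V j)"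
        using inv[OF \<tau>] less.prems(2) by (fastforce simp: V_def I_def)
      \<comment> \<open>Pulling back along \<open>g \<tau>\<close> stretches distances by at most
        \<open>1 / r \<tau>\<close>.\<close>
      moreover have dist_V: "dist u v \<le> diameter (U j) / r \<tau>" if "u \<in> V j" "v \<in> V j" "j \<in> J" for u v j
      proof -
        have "r \<tau> * dist u v \<le> dist (g \<tau> u) (g \<tau> v)"
          using that by (intro low \<tau>) (auto simp: V_def)
        also have "\<dots> \<le> diameter (U j)"
          using that less.prems(3) by (intro diameter_bounded_bound) (auto simp: V_def)
        finally show ?thesis using r[OF \<tau>] by (simp add: field_simps)
      qed
      moreover have bV: "\<forall>j\<in>I \<tau>. bounded (V j)"
        using dist_V unfolding bounded_two_points I_def by blast
      ultimately have "\<Delta> powr s \<le> (\<Sum>j\<in>I \<tau>. diameter (V j) powr s)"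
        using less.hyps I_fin by blast
      also have "\<dots> \<le> (\<Sum>j\<in>I \<tau>. (diameter (U j) / r \<tau>) powr s)"
      proof (intro sum_mono powr_mono2)
        fix j assume "j \<in> I \<tau>"
        then show "0 \<le> diameter (V j)" using bV diameter_ge_0 by blast
        have "0 \<le> diameter (U j)"
          using \<open>j \<in> I \<tau>\<close> less.prems(3) diameter_ge_0 by (auto simp: I_def)
        then show "diameter (V j) \<le> diameter (U j) / r \<tau>"
          using dist_V[of _ j] \<open>j \<in> I \<tau>\<close> r[OF \<tau>]
          by (intro diameter_leI) (auto simp: I_def)
      qed (use \<open>0 < s\<close> in auto)
      also have "\<dots> = (\<Sum>j\<in>I \<tau>. diameter (U j) powr s) / r \<tau> powr s"
        unfolding sum_divide_distrib
      proof (rule sum.cong)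
        fix j assume "j \<in> I \<tau>"
        then have "0 \<le> diameter (U j)"
          using less.prems(3) diameter_ge_0 by (auto simp: I_def)
        then show "(diameter (U j) / r \<tau>) powr s = diameter (U j) powr s / r \<tau> powr s"
          using r[OF \<tau>] by (simp add: powr_divide)
      qed simp
      finally show ?thesis
        using r[OF \<tau>] by (simp add: field_simps)
    qed
    \<comment> \<open>The pieces use disjoint parts of the cover, so their shares add up, and
      \<open>sum_r\<close> says that the shares recover the full bound.\<close>
    have "\<Delta> powr s \<le> (\<Sum>\<tau>\<in>T. r \<tau> powr s) * \<Delta> powr s"
      using mult_right_mono[OF sum_r, of "\<Delta> powr s"] by simp
    also have "\<dots> \<le> (\<Sum>\<tau>\<in>T. \<Sum>j\<in>I \<tau>. diameter (U j) powr s)"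
      unfolding sum_distrib_right by (rule sum_mono[OF piece])
    also have "\<dots> = (\<Sum>j\<in>(\<Union>\<tau>\<in>T. I \<tau>). diameter (U j) powr s)"
      using T I_fin disj by (intro sum.UNION_disjoint[symmetric]) auto
    also have "\<dots> \<le> (\<Sum>j\<in>J. diameter (U j) powr s)"
      using less.prems(1) by (intro sum_mono2) (auto simp: I_def)
    finally show ?thesis .
  qed
qed

lemma compact_disjoint_family_gap:
  fixes E :: "'i \<Rightarrow> 'a::metric_space set"
  assumes "finite T" and "\<And>\<tau>. \<tau> \<in> T \<Longrightarrow> compact (E \<tau>)"
    and disj: "\<And>\<tau> \<tau>'. \<tau> \<in> T \<Longrightarrow> \<tau>' \<in> T \<Longrightarrow> \<tau> \<noteq> \<tau>' \<Longrightarrow> E \<tau> \<inter> E \<tau>' = {}"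
  shows "\<exists>\<Delta>>0. \<forall>\<tau>\<in>T. \<forall>\<tau>'\<in>T. \<tau> \<noteq> \<tau>' \<longrightarrow> (\<forall>x\<in>E \<tau>. \<forall>y\<in>E \<tau>'. \<Delta> \<le> dist x y)"
proof -
  have "\<exists>d>0. \<forall>x\<in>E \<tau>. \<forall>y\<in>E \<tau>'. d \<le> dist x y" if \<tau>: "\<tau> \<in> T" "\<tau>' \<in> T" "\<tau> \<noteq> \<tau>'" for \<tau> \<tau>'
  proof (cases "E \<tau> \<times> E \<tau>' = {}")
    case True
    then show ?thesis by (intro exI[of _ 1]) auto
  next
    case False
    have "compact (E \<tau> \<times> E \<tau>')"
      using \<tau> assms(2) by (intro compact_Times)
    moreover have "continuous_on (E \<tau> \<times> E \<tau>') (\<lambda>p. dist (fst p) (snd p))"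
      by (intro continuous_intros)
    ultimately obtain p where p: "p \<in> E \<tau> \<times> E \<tau>'"
      "\<And>q. q \<in> E \<tau> \<times> E \<tau>' \<Longrightarrow> dist (fst p) (snd p) \<le> dist (fst q) (snd q)"
      using continuous_attains_inf[OF _ False] by blast
    have "0 < dist (fst p) (snd p)"
      using p(1) disj[OF \<tau>] by (auto simp: mem_Times_iff)
    moreover have "\<forall>x\<in>E \<tau>. \<forall>y\<in>E \<tau>'. dist (fst p) (snd p) \<le> dist x y"
      using p(2) by force
    ultimately show ?thesis by blast
  qed
  then have "\<exists>d>0. \<tau> \<noteq> \<tau>' \<longrightarrow> (\<forall>x\<in>E \<tau>. \<forall>y\<in>E \<tau>'. d \<le> dist x y)" if "\<tau> \<in> T" "\<tau>' \<in> T" for \<tau> \<tau>'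
    using that by (cases "\<tau> = \<tau>'") (auto intro: exI[of _ 1])
  then obtain d where d: "\<And>\<tau> \<tau>'. \<tau> \<in> T \<Longrightarrow> \<tau>' \<in> T \<Longrightarrow> 0 < d \<tau> \<tau>'"
    "\<And>\<tau> \<tau>' x y. \<tau> \<in> T \<Longrightarrow> \<tau>' \<in> T \<Longrightarrow> \<tau> \<noteq> \<tau>' \<Longrightarrow> x \<in> E \<tau> \<Longrightarrow> y \<in> E \<tau>' \<Longrightarrow> d \<tau> \<tau>' \<le> dist x y"
    by metis
  \<comment> \<open>The inserted 1 keeps the set nonempty when \<open>T\<close> is empty; the
    diagonal pairs merely contribute further positive numbers.\<close>
  define \<Delta> where "\<Delta> = Min (insert 1 (case_prod d ` (T \<times> T)))"
  have "0 < \<Delta>"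
    unfolding \<Delta>_def using d(1) \<open>finite T\<close> by (subst Min_gr_iff) auto
  moreover have "\<Delta> \<le> dist x y" if "\<tau> \<in> T" "\<tau>' \<in> T" "\<tau> \<noteq> \<tau>'" "x \<in> E \<tau>" "y \<in> E \<tau>'" for \<tau> \<tau>' x y
  proof -
    have "\<Delta> \<le> d \<tau> \<tau>'"
      unfolding \<Delta>_def using that \<open>finite T\<close> by (intro Min_le) force+
    with d(2)[OF that] show ?thesis by linarith
  qed
  ultimately show ?thesis by blast
qed

text \<open>The cover estimates require a positive exponent, so \<open>s = 0\<close> is settled
  here: a single nonempty member already counts 1.\<close>

lemma hausdorff_measure_0_neq_0:
  assumes "A \<noteq> {}"
  shows "hausdorff_measure 0 A \<noteq> 0"
proof -
  have "1 \<le> hausdorff_premeasure 0 1 A"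
    unfolding hausdorff_premeasure_def
  proof (rule Inf_greatest, clarify)
    fix C :: "nat \<Rightarrow> 'a set"
    assume "A \<subseteq> (\<Union>n. C n)"
    with assms obtain n where "C n \<noteq> {}" by blast
    then have "1 = (\<Sum>j\<in>{n}. hausdorff_gauge 0 (C j))"
      by (simp add: hausdorff_gauge_def)
    also have "\<dots> \<le> (\<Sum>j. hausdorff_gauge 0 (C j))"
      by (rule sum_le_suminf) auto
    finally show "1 \<le> (\<Sum>j. hausdorff_gauge 0 (C j))" .
  qed
  also have "\<dots> \<le> hausdorff_measure 0 A"
    unfolding hausdorff_measure_def by (rule SUP_upper) simp
  finally show ?thesis by (metis not_one_le_zero)
qed

section \<open>Systems of infinitesimal similitudes\<close>

text \<open>Stands for dividing by \<open>n\<close> and letting \<open>n\<close> tend to infinity;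
  it removes the bounded errors when two exponential rates are compared.\<close>

lemma nonpos_if_multiples_bounded:
  fixes a b :: real
  assumes "\<And>n::nat. real n * a \<le> b"
  shows "a \<le> 0"
proof (rule ccontr)
  assume "\<not> a \<le> 0"
  then obtain n :: nat where "b < real n * a"
    using reals_Archimedean3[of a] by auto
  with assms[of n] show False by linarith
qed

section \<open>Words, their maps and their derivatives\<close>

primrec word_map :: "(nat \<Rightarrow> 'a \<Rightarrow> 'a) \<Rightarrow> nat list \<Rightarrow> 'a \<Rightarrow> 'a" where
  "word_map f [] x = x"
| "word_map f (i # w) x = f i (word_map f w x)"

text \<open>The chain rule product along the orbit of \<open>x\<close>, taken as the definition
  instead of \<open>inf_deriv (word_map f w)\<close>. Multiplicativity under concatenation is then
  immediate.\<close>

primrec word_deriv :: "(nat \<Rightarrow> 'a::metric_space \<Rightarrow> 'a) \<Rightarrow> nat list \<Rightarrow> 'a \<Rightarrow> real" where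
  "word_deriv f [] x = 1"
| "word_deriv f (i # w) x = inf_deriv (f i) (word_map f w x) * word_deriv f w x"

lemma word_map_append: "word_map f (v @ w) x = word_map f v (word_map f w x)"
  by (induction v) auto

lemma word_deriv_append:
  "word_deriv f (v @ w) x = word_deriv f v (word_map f w x) * word_deriv f w x"
  by (induction v) (auto simp: word_map_append)

definition words :: "nat \<Rightarrow> nat \<Rightarrow> nat list set" where
  "words N n = {w. set w \<subseteq> {1..N} \<and> length w = n}"

lemma finite_words [simp]: "finite (words N n)"
  unfolding words_def by (rule finite_lists_length_eq) simp

lemma card_words: "card (words N n) = N ^ n"
  unfolding words_def by (simp add: card_lists_length_eq)

lemma words_0 [simp]: "words N 0 = {[]}"
  by (auto simp: words_def)

lemma sum_words_Suc: "(\<Sum>w\<in>words N (Suc n). h w) = (\<Sum>i=1..N. \<Sum>w\<in>words N n. h (i # w))"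
proof -
  have "bij_betw (\<lambda>(i, w). i # w) ({1..N} \<times> words N n) (words N (Suc n))"
    by (auto simp: bij_betw_def inj_on_def words_def length_Suc_conv image_iff)
  from sum.reindex_bij_betw[OF this, of h] show ?thesis
    by (simp add: sum.cartesian_product case_prod_unfold)
qed

lemma sum_words_add:
  "(\<Sum>w\<in>words N (m + n). h w) = (\<Sum>v\<in>words N m. \<Sum>w\<in>words N n. h (v @ w))"
  by (induction m arbitrary: h) (simp_all add: sum_words_Suc)

text \<open>Makes the Neumann series of \<open>not_in_op_spectrum\<close> available on the space of
  continuous functions.\<close>

instance bcontfun :: (metric_space, banach) banach ..

text \<open>A common coefficient with \<open>0 < c < 1\<close> lets all words of length
  \<open>n\<close> contract by \<open>c ^ n\<close>, and \<open>ln c\<close> is a negative number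
  that bounds the slope of the pressure.\<close>

locale infinitesimal_ifs =
  fixes f :: "nat \<Rightarrow> 'a::metric_space \<Rightarrow> 'a" and N :: nat and c :: real
  assumes compact_UNIV: "compact (UNIV :: 'a set)"
    and N_pos: "1 \<le> N"
    and c_pos: "0 < c" and c_less_1: "c < 1"
    and similitude: "i \<in> {1..N} \<Longrightarrow> inf_similitude (f i)"
    and deriv_pos: "i \<in> {1..N} \<Longrightarrow> 0 < inf_deriv (f i) x"
    and deriv_hoelder: "i \<in> {1..N} \<Longrightarrow> hoelder_continuous (inf_deriv (f i))"
    and contract: "i \<in> {1..N} \<Longrightarrow> dist (f i x) (f i y) \<le> c * dist x y"
begin

abbreviation D :: "nat \<Rightarrow> 'a \<Rightarrow> real" where
  "D i \<equiv> inf_deriv (f i)"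

abbreviation wmap :: "nat list \<Rightarrow> 'a \<Rightarrow> 'a" where
  "wmap \<equiv> word_map f"

abbreviation wderiv :: "nat list \<Rightarrow> 'a \<Rightarrow> real" where
  "wderiv \<equiv> word_deriv f"

section \<open>Bounds for the derivatives and bounded distortion\<close>

lemma inf_derivs_eq:
  assumes "i \<in> {1..N}"
  shows "inf_derivs (f i) x = {D i x}"
  using similitude[OF assms]
  by (simp add: inf_similitude_def inf_similitude_at_def inf_deriv_def is_singleton_the_elem)

lemma deriv_le:
  assumes i: "i \<in> {1..N}"
  shows "D i x \<le> c"
proof -
  have "D i x \<in> inf_derivs (f i) x"
    by (simp add: inf_derivs_eq[OF i])
  then obtain u v where "\<forall>n. u n \<noteq> v n"
    and lim: "(\<lambda>n. dist (f i (u n)) (f i (v n)) / dist (u n) (v n)) \<longlonglongrightarrow> D i x"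
    unfolding inf_derivs_def by blast
  then have "dist (f i (u n)) (f i (v n)) / dist (u n) (v n) \<le> c" for n
    using contract[OF i, of "u n" "v n"] by (simp add: divide_le_eq)
  then show ?thesis
    by (intro LIMSEQ_le_const2[OF lim]) auto
qed

lemma continuous_map:
  assumes "i \<in> {1..N}"
  shows "continuous_on S (f i)"
  using contract[OF assms] c_pos
  by (intro lipschitz_on_continuous_on[of c] lipschitz_onI) auto

lemma continuous_deriv:
  assumes "i \<in> {1..N}"
  shows "continuous_on S (D i)"
proof -
  obtain C \<alpha> where \<alpha>: "0 < \<alpha>" and C: "\<And>x y. \<bar>D i x - D i y\<bar> \<le> C * dist x y powr \<alpha>"
    using deriv_hoelder[OF assms] unfolding hoelder_continuous_def by blast
  have "(D i \<longlongrightarrow> D i x) (at x within S)" for x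
  proof (rule LIM_zero_cancel, rule Lim_null_comparison)
    show "\<forall>\<^sub>F y in at x within S. norm (D i y - D i x) \<le> C * dist y x powr \<alpha>"
      using C by (auto intro!: always_eventually)
    have "((\<lambda>y. dist y x powr \<alpha>) \<longlongrightarrow> 0 powr \<alpha>) (at x within S)"
      using \<alpha> by (intro tendsto_powr2 tendsto_eq_intros) auto
    then show "((\<lambda>y. C * dist y x powr \<alpha>) \<longlongrightarrow> 0) (at x within S)"
      using \<alpha> by (auto intro: tendsto_mult_right_zero)
  qed
  then show ?thesis
    by (simp add: continuous_on_def)
qed

lemma deriv_lower_bound:
  obtains m where "0 < m" "m \<le> 1" "\<And>i x. i \<in> {1..N} \<Longrightarrow> m \<le> D i x"
proof -
  have "\<exists>x. \<forall>y. D i x \<le> D i y" if "i \<in> {1..N}" for i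
    using continuous_attains_inf[OF compact_UNIV _ continuous_deriv[OF that]] by auto
  then obtain p where p: "\<And>i y. i \<in> {1..N} \<Longrightarrow> D i (p i) \<le> D i y"
    by metis
  define m where "m = Min ((\<lambda>i. D i (p i)) ` {1..N})"
  have le: "m \<le> D i x" if "i \<in> {1..N}" for i x
  proof -
    have "m \<le> D i (p i)"
      unfolding m_def using that by (intro Min_le) auto
    with p[OF that, of x] show ?thesis by linarith
  qed
  have "0 < m"
    unfolding m_def using N_pos deriv_pos by (subst Min_gr_iff) auto
  moreover have "m \<le> 1"
    using le[of 1 undefined] deriv_le[of 1 undefined] N_pos c_less_1 by auto
  ultimately show thesis
    using le that by blast
qed

lemma diameter_bound:
  obtains R where "0 < R" "\<And>x y :: 'a. dist x y \<le> R"
proof -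
  obtain e where e: "\<And>x y :: 'a. dist x y \<le> e"
    using compact_imp_bounded[OF compact_UNIV] unfolding bounded_two_points by blast
  then have "0 < max e 1" "\<And>x y :: 'a. dist x y \<le> max e 1"
    by (auto intro: le_max_iff_disj[THEN iffD2])
  then show thesis by (rule that)
qed

lemma wmap_contract:
  assumes "set w \<subseteq> {1..N}"
  shows "dist (wmap w x) (wmap w y) \<le> c ^ length w * dist x y"
  using assms
proof (induction w)
  case (Cons i w)
  then have "dist (wmap (i # w) x) (wmap (i # w) y) \<le> c * dist (wmap w x) (wmap w y)"
    using contract by simp
  also have "\<dots> \<le> c * (c ^ length w * dist x y)"
    using Cons c_pos by (intro mult_left_mono) auto
  finally show ?case by simp
qed simp

lemma wmap_dist_le:
  assumes "set w \<subseteq> {1..N}"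
  shows "dist (wmap w x) (wmap w y) \<le> dist x y"
proof -
  have "c ^ length w * dist x y \<le> 1 * dist x y"
    using c_pos c_less_1 by (intro mult_right_mono power_le_one) auto
  with wmap_contract[OF assms, of x y] show ?thesis by linarith
qed

lemma wderiv_pos:
  assumes "set w \<subseteq> {1..N}"
  shows "0 < wderiv w x"
  using assms by (induction w) (auto simp: deriv_pos)

lemma wderiv_le:
  assumes "set w \<subseteq> {1..N}"
  shows "wderiv w x \<le> c ^ length w"
  using assms
proof (induction w)
  case (Cons i w)
  then show ?case
    using deriv_le[of i] wderiv_pos[of w x] c_pos by (auto intro!: mult_mono)
qed simp

lemma wderiv_ge:
  assumes "0 < m" and "\<And>i x. i \<in> {1..N} \<Longrightarrow> m \<le> D i x" and "set w \<subseteq> {1..N}"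
  shows "m ^ length w \<le> wderiv w x"
  using assms(3)
proof (induction w)
  case (Cons i w)
  then show ?case
    using assms(1,2) less_imp_le[OF deriv_pos[of i]] by (auto intro!: mult_mono)
qed simp

text \<open>At distance \<open>R * c ^ k\<close> the Hoelder condition bounds the variation of a
  derivative by a geometric sequence in \<open>k\<close>. Summability is what Hoelder continuity
  provides beyond plain continuity.\<close>

lemma deriv_distortion:
  assumes R: "0 < R"
  obtains h where "summable h" "\<And>k. 0 \<le> h k"
    "\<And>i k x y. i \<in> {1..N} \<Longrightarrow> dist x y \<le> R * c ^ k \<Longrightarrow> D i x \<le> D i y * exp (h k)"
proof -
  obtain m where m: "0 < m" "m \<le> 1" "\<And>i x. i \<in> {1..N} \<Longrightarrow> m \<le> D i x"
    using deriv_lower_bound by metis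
  have "\<forall>i\<in>{1..N}. \<exists>C \<alpha>. 0 \<le> C \<and> 0 < \<alpha> \<and> (\<forall>x y. \<bar>D i x - D i y\<bar> \<le> C * dist x y powr \<alpha>)"
    using deriv_hoelder unfolding hoelder_continuous_def by blast
  then obtain C \<alpha> where C: "\<And>i. i \<in> {1..N} \<Longrightarrow> 0 \<le> C i" and \<alpha>: "\<And>i. i \<in> {1..N} \<Longrightarrow> 0 < \<alpha> i"
    and hoelder: "\<And>i x y. i \<in> {1..N} \<Longrightarrow> \<bar>D i x - D i y\<bar> \<le> C i * dist x y powr \<alpha> i"
    by metis
  \<comment> \<open>Dividing by the lower bound \<open>m\<close> turns the additive error into a
    relative one; summing over \<open>i\<close> gives one sequence for maps with different constants
    and exponents.\<close>
  define h where "h k = (\<Sum>i=1..N. C i / m * (R * c ^ k) powr \<alpha> i)" for k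
  show thesis
  proof
    show "summable h"
      unfolding h_def
    proof (rule summable_sum)
      fix i assume i: "i \<in> {1..N}"
      have "c powr \<alpha> i < 1"
        using \<alpha>[OF i] c_pos c_less_1 powr_less_mono2[of "\<alpha> i" c 1] by simp
      then have "summable (\<lambda>k. C i / m * R powr \<alpha> i * (c powr \<alpha> i) ^ k)"
        by (intro summable_mult summable_geometric) simp
      then show "summable (\<lambda>k. C i / m * (R * c ^ k) powr \<alpha> i)"
        using R c_pos by (simp add: powr_mult powr_power powr_realpow[symmetric] powr_powr mult_ac)
    qed
    show "0 \<le> h k" for k
      unfolding h_def using C m(1) by (intro sum_nonneg) auto
    fix i k and x y :: 'a
    assume i: "i \<in> {1..N}" and xy: "dist x y \<le> R * c ^ k"
    have "C i / m * (R * c ^ k) powr \<alpha> i \<le> h k"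
      unfolding h_def using i C m(1) by (intro member_le_sum) auto
    then have "C i * (R * c ^ k) powr \<alpha> i \<le> m * h k"
      using m(1) by (simp add: field_simps)
    moreover have "C i * dist x y powr \<alpha> i \<le> C i * (R * c ^ k) powr \<alpha> i"
      using C[OF i] \<alpha>[OF i] xy by (intro mult_left_mono powr_mono2) auto
    moreover have "m * h k \<le> D i y * h k"
      using m(3)[OF i] \<open>\<And>k. 0 \<le> h k\<close> by (intro mult_right_mono)
    moreover have "D i x \<le> D i y + C i * dist x y powr \<alpha> i"
      using hoelder[OF i, of x y] by linarith
    ultimately have "D i x \<le> D i y * (1 + h k)"
      by (simp add: algebra_simps)
    also have "\<dots> \<le> D i y * exp (h k)"
      using deriv_pos[OF i, of y] by (intro mult_left_mono) auto
    finally show "D i x \<le> D i y * exp (h k)" .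
  qed
qed

text \<open>In \<open>i # w\<close> the letter \<open>i\<close> is evaluated on the image of
  \<open>wmap w\<close>, of diameter at most \<open>R * c ^ length w\<close>. The distortion factors
  of the letters thus multiply to at most \<open>exp (suminf h)\<close>, whatever the
  length.\<close>

lemma bounded_distortion:
  obtains B where "1 \<le> B" "\<And>w x y. set w \<subseteq> {1..N} \<Longrightarrow> wderiv w x \<le> B * wderiv w y"
proof -
  obtain R where R: "0 < R" "\<And>x y :: 'a. dist x y \<le> R"
    using diameter_bound by metis
  obtain h where h: "summable h" "\<And>k. 0 \<le> h k"
    "\<And>i k x y. i \<in> {1..N} \<Longrightarrow> dist x y \<le> R * c ^ k \<Longrightarrow> D i x \<le> D i y * exp (h k)"
    using deriv_distortion[OF R(1)] by metis
  have step: "wderiv w x \<le> exp (\<Sum>k<length w. h k) * wderiv w y" if "set w \<subseteq> {1..N}" for w x y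
    using that
  proof (induction w)
    case (Cons i w)
    have "dist (wmap w x) (wmap w y) \<le> c ^ length w * dist x y"
      using Cons.prems by (intro wmap_contract) auto
    also have "\<dots> \<le> R * c ^ length w"
      using R c_pos by (simp add: mult.commute)
    finally have "D i (wmap w x) \<le> D i (wmap w y) * exp (h (length w))"
      using Cons.prems h(3) by simp
    moreover have "wderiv w x \<le> exp (\<Sum>k<length w. h k) * wderiv w y"
      using Cons by simp
    ultimately have "D i (wmap w x) * wderiv w x
        \<le> (D i (wmap w y) * exp (h (length w))) * (exp (\<Sum>k<length w. h k) * wderiv w y)"
      using Cons.prems deriv_pos[of i] wderiv_pos[of w x] by (intro mult_mono) (auto intro: less_imp_le)
    then show ?case
      by (simp add: exp_add mult_ac)
  qed simp
  show thesis
  proof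
    show "1 \<le> exp (suminf h)"
      using suminf_nonneg[OF h(1,2)] by simp
    fix w x y
    assume w: "set w \<subseteq> {1..N}"
    have "exp (\<Sum>k<length w. h k) \<le> exp (suminf h)"
      using h by (simp add: sum_le_suminf)
    then show "wderiv w x \<le> exp (suminf h) * wderiv w y"
      using step[OF w, of x y] wderiv_pos[OF w, of y]
      by (meson less_imp_le mult_right_mono order_trans)
  qed
qed

section \<open>Partition sums and pressure\<close>

definition partition_sum :: "real \<Rightarrow> nat \<Rightarrow> 'a \<Rightarrow> real" where
  "partition_sum \<sigma> n x = (\<Sum>w\<in>words N n. wderiv w x powr \<sigma>)"

lemma words_subset: "w \<in> words N n \<Longrightarrow> set w \<subseteq> {1..N}"
  and words_length: "w \<in> words N n \<Longrightarrow> length w = n"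
  by (auto simp: words_def)

lemma partition_sum_pos: "0 < partition_sum \<sigma> n x"
proof -
  have "card (words N n) \<noteq> 0"
    using N_pos by (simp add: card_words)
  then have "words N n \<noteq> {}" by auto
  moreover have "0 < wderiv w x" if "w \<in> words N n" for w
    using wderiv_pos words_subset[OF that] by blast
  ultimately show ?thesis
    unfolding partition_sum_def by (intro sum_pos) (auto simp: less_imp_neq[symmetric])
qed

lemma partition_sum_growth:
  assumes "0 \<le> \<sigma>"
  shows "\<exists>l k. \<forall>n x. exp (real n * l - k) \<le> partition_sum \<sigma> n x \<and>
    partition_sum \<sigma> n x \<le> exp (real n * l + k)"
proof -
  obtain B where B: "1 \<le> B" "\<And>w x y. set w \<subseteq> {1..N} \<Longrightarrow> wderiv w x \<le> B * wderiv w y"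
    using bounded_distortion by metis
  let ?Z = "partition_sum \<sigma>"
  define b where "b = \<sigma> * ln B"
  have b: "0 \<le> b" and exp_b: "exp b = B powr \<sigma>"
    using B(1) \<open>0 \<le> \<sigma>\<close> by (auto simp: b_def powr_def)
  have word: "wderiv w x powr \<sigma> \<le> exp b * wderiv w y powr \<sigma>" if "set w \<subseteq> {1..N}" for w x y
  proof -
    have "wderiv w x powr \<sigma> \<le> (B * wderiv w y) powr \<sigma>"
      using B(2)[OF that] wderiv_pos[OF that, of x] \<open>0 \<le> \<sigma>\<close> by (intro powr_mono2) auto
    then show ?thesis
      using B(1) wderiv_pos[OF that, of y] by (simp add: powr_mult exp_b)
  qed
  have compare: "?Z n x \<le> exp b * ?Z n y" for n x y
    unfolding partition_sum_def sum_distrib_left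
    by (intro sum_mono word) (rule words_subset)
  \<comment> \<open>Cutting a word into head and tail evaluates the head at the moved point
    \<open>wmap w x\<close>; \<open>compare\<close> moves it back to \<open>x\<close> at the cost
    \<open>exp b\<close>, in either direction.\<close>
  have split: "?Z (m + n) x = (\<Sum>w\<in>words N n. ?Z m (wmap w x) * wderiv w x powr \<sigma>)" for m n x
  proof -
    have "?Z (m + n) x = (\<Sum>v\<in>words N m. \<Sum>w\<in>words N n.
        wderiv v (wmap w x) powr \<sigma> * wderiv w x powr \<sigma>)"
      unfolding partition_sum_def sum_words_add word_deriv_append
      by (intro sum.cong refl powr_mult; meson less_imp_le wderiv_pos words_subset)
    also have "\<dots> = (\<Sum>w\<in>words N n. \<Sum>v\<in>words N m.
        wderiv v (wmap w x) powr \<sigma> * wderiv w x powr \<sigma>)"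
      by (rule sum.swap)
    finally show ?thesis
      by (simp add: partition_sum_def sum_distrib_right)
  qed
  have upper: "?Z (m + n) x \<le> exp b * ?Z m x * ?Z n x" for m n x
  proof -
    have "?Z (m + n) x \<le> (\<Sum>w\<in>words N n. exp b * ?Z m x * wderiv w x powr \<sigma>)"
      unfolding split by (intro sum_mono mult_right_mono compare) auto
    then show ?thesis
      by (simp add: sum_distrib_left[symmetric] partition_sum_def[of _ n])
  qed
  have lower: "?Z m x * ?Z n x \<le> exp b * ?Z (m + n) x" for m n x
  proof -
    have "?Z m x * ?Z n x = (\<Sum>w\<in>words N n. ?Z m x * wderiv w x powr \<sigma>)"
      by (simp add: sum_distrib_left[symmetric] partition_sum_def[of _ n])
    also have "\<dots> \<le> (\<Sum>w\<in>words N n. exp b * ?Z m (wmap w x) * wderiv w x powr \<sigma>)"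
      by (intro sum_mono mult_right_mono compare) auto
    also have "\<dots> = exp b * ?Z (m + n) x"
      unfolding split by (simp add: sum_distrib_left mult_ac)
    finally show ?thesis .
  qed
  \<comment> \<open>Any base point will do. Passing from it to another point costs a second
    \<open>b\<close>, hence the final constant \<open>2 * b\<close>.\<close>
  define x0 :: 'a where "x0 = undefined"
  define a where "a n = ln (?Z n x0)" for n
  have exp_a: "?Z n x0 = exp (a n)" for n
    by (simp add: a_def partition_sum_pos)
  have "\<bar>a (m + n) - a m - a n\<bar> \<le> b" for m n
    using upper[of m n x0] lower[of m x0 n] unfolding exp_a exp_add[symmetric] exp_le_cancel_iff
    by linarith
  then obtain l where l: "\<And>n. \<bar>a n - real n * l\<bar> \<le> b"
    using almost_additive_growth by blast
  have "exp (real n * l - 2 * b) \<le> ?Z n x \<and> ?Z n x \<le> exp (real n * l + 2 * b)" for n x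
  proof
    have "?Z n x \<le> exp (b + a n)"
      using compare[of n x x0] by (simp add: exp_a exp_add)
    also have "\<dots> \<le> exp (real n * l + 2 * b)"
      using l[of n] by simp
    finally show "?Z n x \<le> exp (real n * l + 2 * b)" .
    have "exp (real n * l - 2 * b) \<le> exp (a n - b)"
      using l[of n] by simp
    also have "\<dots> \<le> ?Z n x"
      using compare[of n x0 x] by (simp add: exp_a exp_diff divide_le_eq mult.commute)
    finally show "exp (real n * l - 2 * b) \<le> ?Z n x" .
  qed
  then show ?thesis by blast
qed

text \<open>The topological pressure of the potential \<open>\<sigma> * ln D\<close>, that is, the
  limit of \<open>ln (partition_sum \<sigma> n x) / n\<close>. For \<open>0 \<le> \<sigma>\<close>
  the choice is from a singleton, since two-sided bounds determine the rate.\<close>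

definition pressure :: "real \<Rightarrow> real" where
  "pressure \<sigma> = (SOME l. \<exists>k. \<forall>n x. exp (real n * l - k) \<le> partition_sum \<sigma> n x \<and>
    partition_sum \<sigma> n x \<le> exp (real n * l + k))"

lemma pressure:
  assumes "0 \<le> \<sigma>"
  obtains k where "\<And>n x. exp (real n * pressure \<sigma> - k) \<le> partition_sum \<sigma> n x"
    "\<And>n x. partition_sum \<sigma> n x \<le> exp (real n * pressure \<sigma> + k)"
  using someI_ex[OF partition_sum_growth[OF assms]] that unfolding pressure_def by blast

text \<open>Every word of length \<open>n\<close> has its derivative between \<open>m ^ n\<close>
  and \<open>c ^ n\<close>, so raising the exponent by \<open>h\<close> changes each term by a
  factor between the \<open>h\<close>-th powers of these. The first bound gives strict decrease, the
  second continuity.\<close>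

lemma pressure_add:
  assumes "0 \<le> \<sigma>" and "0 \<le> h"
  shows "pressure (\<sigma> + h) \<le> pressure \<sigma> + h * ln c"
    and "0 < m \<Longrightarrow> (\<And>i x. i \<in> {1..N} \<Longrightarrow> m \<le> D i x) \<Longrightarrow>
      pressure \<sigma> + h * ln m \<le> pressure (\<sigma> + h)"
proof -
  obtain k where k: "\<And>n x. exp (real n * pressure \<sigma> - k) \<le> partition_sum \<sigma> n x"
    "\<And>n x. partition_sum \<sigma> n x \<le> exp (real n * pressure \<sigma> + k)"
    using pressure[OF assms(1)] by metis
  obtain k' where k': "\<And>n x. exp (real n * pressure (\<sigma> + h) - k') \<le> partition_sum (\<sigma> + h) n x"
    "\<And>n x. partition_sum (\<sigma> + h) n x \<le> exp (real n * pressure (\<sigma> + h) + k')"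
    using pressure[of "\<sigma> + h"] assms by auto
  have split: "partition_sum (\<sigma> + h) n x = (\<Sum>w\<in>words N n. wderiv w x powr h * wderiv w x powr \<sigma>)"
    for n x
    by (simp add: partition_sum_def powr_add mult.commute)
  have pow: "(r ^ n) powr h = exp (real n * (h * ln r))" if "0 < r" for r n
    using that by (simp add: powr_def ln_realpow mult_ac)
  have "partition_sum (\<sigma> + h) n x \<le> exp (real n * (h * ln c)) * partition_sum \<sigma> n x" for n x
    unfolding partition_sum_def[of \<sigma>] split sum_distrib_left
  proof (intro sum_mono mult_right_mono)
    fix w assume w: "w \<in> words N n"
    have "wderiv w x powr h \<le> (c ^ n) powr h"
      using wderiv_le[OF words_subset[OF w], of x] wderiv_pos[OF words_subset[OF w], of x]
        words_length[OF w] assms(2) by (intro powr_mono2) auto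
    then show "wderiv w x powr h \<le> exp (real n * (h * ln c))"
      by (simp add: pow c_pos)
  qed auto
  then have "exp (real n * pressure (\<sigma> + h) - k')
      \<le> exp (real n * (h * ln c)) * exp (real n * pressure \<sigma> + k)" for n
    using k'(1)[of n undefined] k(2)[of n undefined]
    by (meson exp_ge_zero mult_left_mono order_trans)
  then have "real n * (pressure (\<sigma> + h) - (pressure \<sigma> + h * ln c)) \<le> k + k'" for n
    unfolding exp_add[symmetric] exp_le_cancel_iff by (simp add: algebra_simps)
  from nonpos_if_multiples_bounded[OF this]
  show "pressure (\<sigma> + h) \<le> pressure \<sigma> + h * ln c" by simp
  assume m: "0 < m" "\<And>i x. i \<in> {1..N} \<Longrightarrow> m \<le> D i x"
  have "exp (real n * (h * ln m)) * partition_sum \<sigma> n x \<le> partition_sum (\<sigma> + h) n x" for n x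
    unfolding partition_sum_def[of \<sigma>] split sum_distrib_left
  proof (intro sum_mono mult_right_mono)
    fix w assume w: "w \<in> words N n"
    have "(m ^ n) powr h \<le> wderiv w x powr h"
      using wderiv_ge[OF m words_subset[OF w], of x] words_length[OF w] assms(2) m(1)
      by (intro powr_mono2) auto
    then show "exp (real n * (h * ln m)) \<le> wderiv w x powr h"
      by (simp add: pow m(1))
  qed auto
  then have "exp (real n * (h * ln m)) * exp (real n * pressure \<sigma> - k)
      \<le> exp (real n * pressure (\<sigma> + h) + k')" for n
    using k'(2)[of n undefined] k(1)[of n undefined]
    by (meson exp_ge_zero mult_left_mono order_trans)
  then have "real n * (pressure \<sigma> + h * ln m - pressure (\<sigma> + h)) \<le> k + k'" for n
    unfolding exp_add[symmetric] exp_le_cancel_iff by (simp add: algebra_simps)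
  from nonpos_if_multiples_bounded[OF this]
  show "pressure \<sigma> + h * ln m \<le> pressure (\<sigma> + h)" by simp
qed

lemma pressure_strict_antimono:
  assumes "0 \<le> \<sigma>" and "\<sigma> < \<tau>"
  shows "pressure \<tau> < pressure \<sigma>"
proof -
  have "pressure \<tau> \<le> pressure \<sigma> + (\<tau> - \<sigma>) * ln c"
    using pressure_add(1)[of \<sigma> "\<tau> - \<sigma>"] assms by simp
  moreover have "(\<tau> - \<sigma>) * ln c < 0"
    using assms c_pos c_less_1 by (intro mult_pos_neg) auto
  ultimately show ?thesis by linarith
qed

lemma pressure_0: "pressure 0 = ln N"
proof -
  obtain k where k: "\<And>n x. exp (real n * pressure 0 - k) \<le> partition_sum 0 n x"
    "\<And>n x. partition_sum 0 n x \<le> exp (real n * pressure 0 + k)"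
    using pressure[of 0] by auto
  have "partition_sum 0 n x = exp (real n * ln N)" for n x
  proof -
    have "partition_sum 0 n x = (\<Sum>w\<in>words N n. 1)"
      unfolding partition_sum_def
      using wderiv_pos words_subset by (intro sum.cong) (auto simp: less_imp_neq[symmetric])
    also have "\<dots> = real N ^ n"
      by (simp add: card_words)
    finally show ?thesis
      using N_pos by (simp add: exp_of_nat_mult)
  qed
  with k have "real n * (pressure 0 - ln N) \<le> k" "real n * (ln N - pressure 0) \<le> k" for n
    by (auto simp: algebra_simps)
  then have "pressure 0 - ln N \<le> 0" "ln N - pressure 0 \<le> 0"
    using nonpos_if_multiples_bounded by blast+
  then show ?thesis by simp
qed

lemma pressure_zero_exists: "\<exists>\<sigma>\<ge>0. pressure \<sigma> = 0"
proof -
  obtain m where m: "0 < m" "m \<le> 1" "\<And>i x. i \<in> {1..N} \<Longrightarrow> m \<le> D i x"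
    using deriv_lower_bound by metis
  \<comment> \<open>Where the line with slope \<open>ln c\<close> through \<open>pressure 0\<close>
    reaches 0; the pressure lies below this line.\<close>
  define S where "S = pressure 0 / - ln c"
  have lnc: "ln c < 0" using c_pos c_less_1 by simp
  have P0: "0 \<le> pressure 0" using N_pos by (simp add: pressure_0)
  then have S: "0 \<le> S" using lnc by (simp add: S_def divide_nonneg_neg)
  have "(- ln m)-lipschitz_on {0..S} pressure"
  proof (rule lipschitz_onI)
    have lip: "dist (pressure x) (pressure y) \<le> - ln m * dist x y" if "0 \<le> x" "x \<le> y" for x y
    proof -
      have "pressure y \<le> pressure x"
        using pressure_strict_antimono[of x y] that by (cases "x = y") auto
      moreover have "pressure x + (y - x) * ln m \<le> pressure y"
        using pressure_add(2)[of x "y - x" m] that m by simp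
      ultimately show ?thesis
        using that by (simp add: dist_real_def algebra_simps)
    qed
    show "dist (pressure x) (pressure y) \<le> - ln m * dist x y" if "x \<in> {0..S}" "y \<in> {0..S}" for x y
      using lip[of x y] lip[of y x] that by (cases "x \<le> y") (auto simp: dist_commute)
    show "0 \<le> - ln m" using m by simp
  qed
  then have "continuous_on {0..S} pressure"
    by (rule lipschitz_on_continuous_on)
  moreover have "pressure S \<le> 0"
    using pressure_add(1)[of 0 S] S lnc by (simp add: S_def)
  ultimately obtain \<sigma> where "0 \<le> \<sigma>" "\<sigma> \<le> S" "pressure \<sigma> = 0"
    using IVT2'[of pressure S 0 0] P0 S by blast
  then show ?thesis by blast
qed

section \<open>Powers of the transfer operator\<close>

lemma apply_transfer_op_funpow:
  "apply_bcontfun ((transfer_op N f \<sigma> ^^ n) g) x =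
    (\<Sum>w\<in>words N n. wderiv w x powr \<sigma> * apply_bcontfun g (wmap w x))"
proof (induction n arbitrary: g)
  case (Suc n)
  have ap: "apply_bcontfun (transfer_op N f \<sigma> g) y =
      (\<Sum>i=1..N. D i y powr \<sigma> * apply_bcontfun g (f i y))" for y
    using compact_UNIV continuous_map continuous_deriv deriv_pos
    by (intro apply_transfer_op) auto
  \<comment> \<open>The operator is peeled off next to \<open>g\<close>: its map acts after
    \<open>wmap w\<close>, which matches the word \<open>i # w\<close>.\<close>
  have "apply_bcontfun ((transfer_op N f \<sigma> ^^ Suc n) g) x =
      (\<Sum>w\<in>words N n. \<Sum>i=1..N.
        wderiv w x powr \<sigma> * (D i (wmap w x) powr \<sigma> * apply_bcontfun g (f i (wmap w x))))"
    unfolding funpow_Suc_right comp_apply Suc ap sum_distrib_left ..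
  also have "\<dots> = (\<Sum>i=1..N. \<Sum>w\<in>words N n.
        wderiv w x powr \<sigma> * (D i (wmap w x) powr \<sigma> * apply_bcontfun g (f i (wmap w x))))"
    by (rule sum.swap)
  also have "\<dots> = (\<Sum>i=1..N. \<Sum>w\<in>words N n.
        wderiv (i # w) x powr \<sigma> * apply_bcontfun g (wmap (i # w) x))"
  proof (intro sum.cong refl)
    fix i w assume "i \<in> {1..N}" "w \<in> words N n"
    then have "0 < D i (wmap w x)" "0 < wderiv w x"
      using deriv_pos wderiv_pos words_subset by blast+
    then show "wderiv w x powr \<sigma> * (D i (wmap w x) powr \<sigma> * apply_bcontfun g (f i (wmap w x)))
        = wderiv (i # w) x powr \<sigma> * apply_bcontfun g (wmap (i # w) x)"
      by (simp add: powr_mult)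
  qed
  finally show ?case by (simp add: sum_words_Suc)
qed simp

lemma op_spectral_radius_transfer_op:
  assumes "0 \<le> \<sigma>"
  shows "op_spectral_radius (transfer_op N f \<sigma>) = exp (pressure \<sigma>)"
proof -
  let ?T = "transfer_op N f \<sigma>" and ?one = "const_bcontfun 1 :: 'a \<Rightarrow>\<^sub>C real"
  obtain k where k: "\<And>n x. exp (real n * pressure \<sigma> - k) \<le> partition_sum \<sigma> n x"
    "\<And>n x. partition_sum \<sigma> n x \<le> exp (real n * pressure \<sigma> + k)"
    using pressure[OF assms] by metis
  show ?thesis
  proof (rule op_spectral_radius_eqI)
    show "bounded_linear ?T"
      using compact_UNIV continuous_map continuous_deriv deriv_pos
      by (intro bounded_linear_transfer_op) auto
    show "norm ((?T ^^ n) g) \<le> exp k * exp (pressure \<sigma>) ^ n * norm g" for n g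
    proof (rule norm_bound)
      fix x
      have "norm (apply_bcontfun ((?T ^^ n) g) x) \<le> (\<Sum>w\<in>words N n. wderiv w x powr \<sigma> * norm g)"
        unfolding apply_transfer_op_funpow
        by (intro sum_norm_le) (simp add: abs_mult mult_left_mono norm_bounded[of g, simplified])
      also have "\<dots> = partition_sum \<sigma> n x * norm g"
        by (simp add: partition_sum_def sum_distrib_right)
      also have "\<dots> \<le> exp (real n * pressure \<sigma> + k) * norm g"
        by (intro mult_right_mono k) auto
      finally show "norm (apply_bcontfun ((?T ^^ n) g) x) \<le> exp k * exp (pressure \<sigma>) ^ n * norm g"
        by (simp add: exp_add exp_of_nat_mult mult_ac)
    qed
    \<comment> \<open>All terms are positive functions, so nothing cancels: at a single point each
      normalised partition sum is at least \<open>exp (- k)\<close>.\<close>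
    show "exp (- k) * real n \<le> norm (\<Sum>j<n. (1 / exp (pressure \<sigma>) ^ j) *\<^sub>R (?T ^^ j) ?one)" for n
    proof -
      let ?v = "\<lambda>n. \<Sum>j<n. (1 / exp (pressure \<sigma>) ^ j) *\<^sub>R (?T ^^ j) ?one"
      have v: "apply_bcontfun (?v n) x = (\<Sum>j<n. partition_sum \<sigma> j x / exp (pressure \<sigma>) ^ j)" for x
        by (induction n) (simp_all add: apply_transfer_op_funpow partition_sum_def)
      have "exp (- k) * real n = (\<Sum>j<n. exp (- k))"
        by simp
      also have "\<dots> \<le> apply_bcontfun (?v n) undefined"
        unfolding v
      proof (rule sum_mono)
        fix j
        show "exp (- k) \<le> partition_sum \<sigma> j undefined / exp (pressure \<sigma>) ^ j"
          using k(1)[of j undefined]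
          by (simp add: le_divide_eq exp_of_nat_mult[symmetric] exp_add[symmetric])
      qed
      also have "\<dots> \<le> norm (?v n)"
        by (rule order_trans[OF abs_ge_self]) (use norm_bounded[of "?v n" undefined] in simp)
      finally show ?thesis .
    qed
  qed auto
qed

section \<open>Uniform near-similitude estimates\<close>

lemma local_similitude:
  assumes "0 < e"
  shows "\<exists>\<delta>>0. \<forall>i\<in>{1..N}. \<forall>x y. dist x y < \<delta> \<longrightarrow>
    \<bar>dist (f i x) (f i y) - D i x * dist x y\<bar> \<le> e * dist x y"
proof (rule ccontr)
  \<comment> \<open>The definition treats each point separately; compactness makes it uniform.
    Violating pairs at distance tending to 0 accumulate at some \<open>x\<close>, and their ratios
    would accumulate at an element of \<open>inf_derivs (f i) x\<close> other than
    \<open>D i x\<close>.\<close>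
  assume *: "\<not> ?thesis"
  have ex: "\<exists>i x y. i \<in> {1..N} \<and> dist x y < \<delta> \<and>
      e * dist x y < \<bar>dist (f i x) (f i y) - D i x * dist x y\<bar>" if "0 < \<delta>" for \<delta>
  proof (rule ccontr)
    assume "\<not> ?thesis"
    then have "\<forall>i\<in>{1..N}. \<forall>x y. dist x y < \<delta> \<longrightarrow>
        \<bar>dist (f i x) (f i y) - D i x * dist x y\<bar> \<le> e * dist x y"
      by (meson not_le)
    with * that show False by blast
  qed
  have "\<exists>i x y. i \<in> {1..N} \<and> dist x y < 1 / real (Suc n) \<and>
      e * dist x y < \<bar>dist (f i x) (f i y) - D i x * dist x y\<bar>" for n
    by (rule ex) simp
  then obtain I u v where I: "\<And>n. I n \<in> {1..N}" and uv: "\<And>n. dist (u n) (v n) < 1 / real (Suc n)"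
    and far: "\<And>n. e * dist (u n) (v n)
      < \<bar>dist (f (I n) (u n)) (f (I n) (v n)) - D (I n) (u n) * dist (u n) (v n)\<bar>"
    by metis
  have neq: "u n \<noteq> v n" for n
    using far[of n] by auto
  define q where "q n = dist (f (I n) (u n)) (f (I n) (v n)) / dist (u n) (v n)" for n
  have q: "q n \<in> {0..c}" for n
    using contract[OF I, of n "u n" "v n"] neq[of n] by (simp add: q_def divide_le_eq)
  have far_q: "e < \<bar>q n - D (I n) (u n)\<bar>" for n
  proof -
    have "dist (f (I n) (u n)) (f (I n) (v n)) - D (I n) (u n) * dist (u n) (v n)
        = (q n - D (I n) (u n)) * dist (u n) (v n)"
      using neq[of n] by (simp add: q_def field_simps)
    then show ?thesis
      using far[of n] neq[of n] by (simp add: abs_mult)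
  qed
  \<comment> \<open>The ratio is part of the product because \<open>inf_derivs\<close> asks for
    convergent ratios; the index becomes constant along the subsequence as its range is
    discrete.\<close>
  have "compact ({1..N} \<times> (UNIV :: 'a set) \<times> {0..c})"
    by (intro compact_Times compact_UNIV compact_Icc finite_imp_compact finite_atLeastAtMost)
  then have "seq_compact ({1..N} \<times> (UNIV :: 'a set) \<times> {0..c})"
    by (rule compact_imp_seq_compact)
  moreover have "\<forall>n. (I n, u n, q n) \<in> {1..N} \<times> (UNIV :: 'a set) \<times> {0..c}"
    using I q by blast
  ultimately obtain l \<phi> where l_mem: "l \<in> {1..N} \<times> (UNIV :: 'a set) \<times> {0..c}"
    and l: "strict_mono \<phi>" "((\<lambda>n. (I n, u n, q n)) \<circ> \<phi>) \<longlonglongrightarrow> l"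
    by (rule seq_compactE)
  from l_mem obtain i x t where i: "i \<in> {1..N}" and l_eq: "l = (i, x, t)" by blast
  have lims: "(\<lambda>n. I (\<phi> n)) \<longlonglongrightarrow> i" "(\<lambda>n. u (\<phi> n)) \<longlonglongrightarrow> x" "(\<lambda>n. q (\<phi> n)) \<longlonglongrightarrow> t"
    using tendsto_fst[OF l(2)] tendsto_fst[OF tendsto_snd[OF l(2)]]
      tendsto_snd[OF tendsto_snd[OF l(2)]] by (simp_all add: l_eq o_def)
  have "\<forall>\<^sub>F n in sequentially. I (\<phi> n) = i"
    using lims(1) by (simp add: tendsto_discrete)
  then obtain n0 where n0: "\<And>n. n0 \<le> n \<Longrightarrow> I (\<phi> n) = i"
    by (auto simp: eventually_sequentially)
  define \<psi> where "\<psi> n = \<phi> (n + n0)" for n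
  have \<psi>: "(\<lambda>n. u (\<psi> n)) \<longlonglongrightarrow> x" "(\<lambda>n. q (\<psi> n)) \<longlonglongrightarrow> t" "\<And>n. I (\<psi> n) = i"
    using LIMSEQ_ignore_initial_segment[OF lims(2), of n0]
      LIMSEQ_ignore_initial_segment[OF lims(3), of n0] n0 by (simp_all add: \<psi>_def)
  have "(\<lambda>n. dist (u n) (v n)) \<longlonglongrightarrow> 0"
    by (rule Lim_null_comparison[OF _ LIMSEQ_inverse_real_of_nat])
      (use uv in \<open>auto intro!: always_eventually less_imp_le simp: inverse_eq_divide\<close>)
  then have "(\<lambda>n. dist (u (\<psi> n)) (v (\<psi> n))) \<longlonglongrightarrow> 0"
    using LIMSEQ_ignore_initial_segment[OF LIMSEQ_subseq_LIMSEQ[OF _ l(1)], of _ 0 n0]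
    by (simp add: \<psi>_def o_def)
  then have sum_null: "(\<lambda>n. dist (u (\<psi> n)) (v (\<psi> n)) + dist (u (\<psi> n)) x) \<longlonglongrightarrow> 0"
    using tendsto_add[OF _ \<psi>(1)[unfolded tendsto_dist_iff[of _ x]]] by fastforce
  have "(\<lambda>n. v (\<psi> n)) \<longlonglongrightarrow> x"
    unfolding tendsto_dist_iff[of _ x]
    by (rule Lim_null_comparison[OF always_eventually sum_null])
      (simp add: dist_triangle3[of _ x])
  moreover have "(\<lambda>n. dist (f i (u (\<psi> n))) (f i (v (\<psi> n))) / dist (u (\<psi> n)) (v (\<psi> n))) \<longlonglongrightarrow> t"
    using \<psi>(2) by (simp add: q_def \<psi>(3))
  ultimately have "t \<in> inf_derivs (f i) x"
    unfolding inf_derivs_def mem_Collect_eq using neq \<psi>(1)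
    by (intro exI[of _ "\<lambda>n. u (\<psi> n)"] exI[of _ "\<lambda>n. v (\<psi> n)"] conjI allI) auto
  then have t: "t = D i x"
    by (simp add: inf_derivs_eq[OF i])
  have "(\<lambda>n. D i (u (\<psi> n))) \<longlonglongrightarrow> D i x"
    using continuous_on_tendsto_compose[OF continuous_deriv[OF i, of UNIV] \<psi>(1)] by simp
  then have "(\<lambda>n. \<bar>q (\<psi> n) - D i (u (\<psi> n))\<bar>) \<longlonglongrightarrow> \<bar>D i x - D i x\<bar>"
    using \<psi>(2) unfolding t by (intro tendsto_intros)
  then have "e \<le> \<bar>D i x - D i x\<bar>"
    by (rule LIMSEQ_le_const) (use far_q \<psi>(3) in \<open>metis less_imp_le\<close>)
  with \<open>0 < e\<close> show False by simp
qed

text \<open>An absolute error \<open>e * m\<close> is a relative error \<open>e\<close>, as all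
  derivatives are at least \<open>m\<close>.\<close>

lemma local_similitude_ratio:
  assumes "0 < e"
  obtains \<delta> where "0 < \<delta>"
    "\<And>i x y. i \<in> {1..N} \<Longrightarrow> dist x y < \<delta> \<Longrightarrow> dist (f i x) (f i y) \<le> (1 + e) * D i x * dist x y"
    "\<And>i x y. i \<in> {1..N} \<Longrightarrow> dist x y < \<delta> \<Longrightarrow> (1 - e) * D i x * dist x y \<le> dist (f i x) (f i y)"
proof -
  obtain m where m: "0 < m" "m \<le> 1" "\<And>i x. i \<in> {1..N} \<Longrightarrow> m \<le> D i x"
    using deriv_lower_bound by metis
  obtain \<delta> where "0 < \<delta>" and \<delta>: "\<And>i x y. i \<in> {1..N} \<Longrightarrow> dist x y < \<delta> \<Longrightarrow>
      \<bar>dist (f i x) (f i y) - D i x * dist x y\<bar> \<le> e * m * dist x y"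
    using local_similitude[of "e * m"] assms m(1) by auto
  have "\<bar>dist (f i x) (f i y) - D i x * dist x y\<bar> \<le> e * D i x * dist x y"
    if "i \<in> {1..N}" "dist x y < \<delta>" for i x y
  proof -
    have "e * m * dist x y \<le> e * D i x * dist x y"
      using m(3)[OF that(1)] assms by (intro mult_right_mono mult_left_mono) auto
    with \<delta>[OF that] show ?thesis by linarith
  qed
  then have "dist (f i x) (f i y) \<le> (1 + e) * D i x * dist x y"
      "(1 - e) * D i x * dist x y \<le> dist (f i x) (f i y)"
    if "i \<in> {1..N}" "dist x y < \<delta>" for i x y
    using that by (fastforce simp: abs_le_iff algebra_simps)+
  with \<open>0 < \<delta>\<close> show thesis using that by blast
qed

text \<open>A new first letter acts on the image of the remaining word. Once that word has at least
  \<open>k\<close> letters, its image is smaller than \<open>\<delta>\<close> and the letter costs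
  only a factor \<open>1 + e\<close>; words of length at most \<open>k\<close> are absorbed in
  \<open>C\<close>.\<close>

lemma wmap_upper:
  assumes "0 < e"
  obtains C where "0 < C"
    "\<And>w x y. set w \<subseteq> {1..N} \<Longrightarrow> dist (wmap w x) (wmap w y) \<le> C * (1 + e) ^ length w * wderiv w x"
proof -
  obtain \<delta> where \<delta>: "0 < \<delta>"
    "\<And>i x y. i \<in> {1..N} \<Longrightarrow> dist x y < \<delta> \<Longrightarrow> dist (f i x) (f i y) \<le> (1 + e) * D i x * dist x y"
    using local_similitude_ratio[OF assms] by metis
  obtain m where m: "0 < m" "m \<le> 1" "\<And>i x. i \<in> {1..N} \<Longrightarrow> m \<le> D i x"
    using deriv_lower_bound by metis
  obtain R where R: "0 < R" "\<And>x y :: 'a. dist x y \<le> R"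
    using diameter_bound by metis
  obtain k where k: "c ^ k < \<delta> / R"
    using real_arch_pow_inv[of "\<delta> / R" c] \<delta>(1) R(1) c_less_1 by auto
  define C where "C = R / m ^ k"
  have "0 < C" using R m by (simp add: C_def)
  have short: "dist (wmap w x) (wmap w y) \<le> C * (1 + e) ^ length w * wderiv w x"
    if w: "set w \<subseteq> {1..N}" "length w \<le> k" for w x y
  proof -
    have "dist (wmap w x) (wmap w y) \<le> C * m ^ k"
      using R m(1) by (simp add: C_def)
    also have "\<dots> \<le> C * wderiv w x"
    proof -
      have "m ^ k \<le> m ^ length w"
        using w m by (intro power_decreasing) auto
      also have "\<dots> \<le> wderiv w x"
        using m w by (intro wderiv_ge) auto
      finally show ?thesis using \<open>0 < C\<close> by simp
    qed
    also have "\<dots> \<le> C * wderiv w x * (1 + e) ^ length w"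
      using assms \<open>0 < C\<close> wderiv_pos[OF w(1), of x] mult_left_mono[of 1 "(1 + e) ^ length w" "C * wderiv w x"]
      by (simp add: one_le_power)
    finally show ?thesis by (simp add: mult_ac)
  qed
  have "dist (wmap w x) (wmap w y) \<le> C * (1 + e) ^ length w * wderiv w x"
    if "set w \<subseteq> {1..N}" for w x y
    using that
  proof (induction w)
    case Nil
    then show ?case using short[of "[]"] by simp
  next
    case (Cons i w)
    show ?case
    proof (cases "length (i # w) \<le> k")
      case True
      with Cons.prems show ?thesis by (rule short)
    next
      case False
      have "dist (wmap w x) (wmap w y) \<le> c ^ length w * dist x y"
        using Cons.prems by (intro wmap_contract) auto
      also have "\<dots> \<le> c ^ k * R"
        using False R c_pos c_less_1 by (intro mult_mono power_decreasing) auto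
      also have "\<dots> < \<delta>"
        using k R by (simp add: field_simps)
      finally have "dist (wmap (i # w) x) (wmap (i # w) y)
          \<le> (1 + e) * D i (wmap w x) * dist (wmap w x) (wmap w y)"
        using Cons.prems \<delta>(2) by simp
      also have "\<dots> \<le> (1 + e) * D i (wmap w x) * (C * (1 + e) ^ length w * wderiv w x)"
        using Cons assms deriv_pos[of i "wmap w x"] by (intro mult_left_mono) auto
      finally show ?thesis by (simp add: mult_ac)
    qed
  qed
  with \<open>0 < C\<close> show thesis by (rule that)
qed

text \<open>Points closer than \<open>\<delta>\<close> remain so under every word, so each letter
  obeys the near-similitude bound and no constant in front arises, in contrast to
  \<open>wmap_upper\<close>.\<close>

lemma wmap_lower:
  assumes "0 < e" and "e < 1"
  obtains \<delta> where "0 < \<delta>"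
    "\<And>w x y. set w \<subseteq> {1..N} \<Longrightarrow> dist x y < \<delta> \<Longrightarrow>
      (1 - e) ^ length w * wderiv w x * dist x y \<le> dist (wmap w x) (wmap w y)"
proof -
  obtain \<delta> where \<delta>: "0 < \<delta>"
    "\<And>i x y. i \<in> {1..N} \<Longrightarrow> dist x y < \<delta> \<Longrightarrow> (1 - e) * D i x * dist x y \<le> dist (f i x) (f i y)"
    using local_similitude_ratio[OF assms(1)] by metis
  have "(1 - e) ^ length w * wderiv w x * dist x y \<le> dist (wmap w x) (wmap w y)"
    if "set w \<subseteq> {1..N}" "dist x y < \<delta>" for w x y
    using that(1)
  proof (induction w)
    case (Cons i w)
    have "(1 - e) ^ length (i # w) * wderiv (i # w) x * dist x y
        = (1 - e) * D i (wmap w x) * ((1 - e) ^ length w * wderiv w x * dist x y)"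
      by simp
    also have "\<dots> \<le> (1 - e) * D i (wmap w x) * dist (wmap w x) (wmap w y)"
      using Cons assms deriv_pos[of i "wmap w x"] by (intro mult_left_mono) auto
    also have "\<dots> \<le> dist (wmap (i # w) x) (wmap (i # w) y)"
      using \<delta>(2)[of i "wmap w x" "wmap w y"] Cons.prems wmap_dist_le[of w x y] that(2) by simp
    finally show ?case .
  qed simp
  with \<delta>(1) show thesis using that by blast
qed

section \<open>Hausdorff dimension of the attractor\<close>

lemma attractor_words:
  assumes "A \<subseteq> (\<Union>i\<in>{1..N}. f i ` A)" and "a \<in> A"
  shows "\<exists>w\<in>words N n. a \<in> wmap w ` A"
  using assms(2)
proof (induction n arbitrary: a)
  case 0
  then show ?case by simp
next
  case (Suc n)
  then obtain i b where i: "i \<in> {1..N}" "b \<in> A" "a = f i b"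
    using assms(1) by blast
  with Suc.IH obtain w b' where "w \<in> words N n" "b' \<in> A" "b = wmap w b'"
    by blast
  with i show ?case
    by (intro bexI[of _ "i # w"]) (auto simp: words_def)
qed

lemma hausdorff_measure_attractor_eq_0:
  assumes cover: "A \<subseteq> (\<Union>i\<in>{1..N}. f i ` A)" and "0 < s" and "pressure s < 0"
  shows "hausdorff_measure s A = 0"
proof (rule hausdorff_measure_eq_0I[OF \<open>0 < s\<close>])
  fix \<delta> \<eta> :: real
  assume "0 < \<delta>" "0 < \<eta>"
  \<comment> \<open>Chosen so that \<open>((1 + e) ^ n) powr s\<close> equals
    \<open>exp (- n * pressure s / 2)\<close>: half of the decay of the partition sum
    survives.\<close>
  define e where "e = exp (- pressure s / (2 * s)) - 1"
  have e: "0 < e" and one_e: "1 + e = exp (- pressure s / (2 * s))"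
    using assms(2,3) by (auto simp: e_def divide_neg_pos)
  obtain C where C: "0 < C"
    "\<And>w x y. set w \<subseteq> {1..N} \<Longrightarrow> dist (wmap w x) (wmap w y) \<le> C * (1 + e) ^ length w * wderiv w x"
    using wmap_upper[OF e] by metis
  obtain B where B: "1 \<le> B" "\<And>w x y. set w \<subseteq> {1..N} \<Longrightarrow> wderiv w x \<le> B * wderiv w y"
    using bounded_distortion by metis
  obtain R where R: "0 < R" "\<And>x y :: 'a. dist x y \<le> R"
    using diameter_bound by metis
  obtain k where k: "\<And>n x. partition_sum s n x \<le> exp (real n * pressure s + k)"
    using pressure[of s] assms(2) by (metis less_imp_le)
  \<comment> \<open>Bounded distortion moves all derivatives to one base point, so that the
    diameters sum to a partition sum.\<close>
  define x0 :: 'a where "x0 = undefined"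
  define bound where "bound n = (C * B) powr s * exp k * exp (pressure s / 2) ^ n" for n
  have diam: "diameter (wmap w ` A) \<le> C * B * (1 + e) ^ n * wderiv w x0"
    "diameter (wmap w ` A) \<le> R * c ^ n" "bounded (wmap w ` A)" "0 \<le> diameter (wmap w ` A)"
    if "w \<in> words N n" for w n
  proof -
    note w = words_subset[OF that] words_length[OF that]
    have "dist x y \<le> C * B * (1 + e) ^ n * wderiv w x0" if "x \<in> wmap w ` A" "y \<in> wmap w ` A" for x y
    proof -
      obtain a b where "x = wmap w a" "y = wmap w b" using \<open>x \<in> _\<close> \<open>y \<in> _\<close> by blast
      then have "dist x y \<le> C * (1 + e) ^ n * wderiv w a"
        using C(2)[OF w(1), of a b] w(2) by simp
      also have "\<dots> \<le> C * (1 + e) ^ n * (B * wderiv w x0)"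
        using B(2)[OF w(1), of a x0] C(1) e by (intro mult_left_mono) auto
      finally show ?thesis by (simp add: mult_ac)
    qed
    then show "diameter (wmap w ` A) \<le> C * B * (1 + e) ^ n * wderiv w x0"
      using C(1) B(1) e wderiv_pos[OF w(1), of x0] by (intro diameter_leI) auto
    have "dist x y \<le> R * c ^ n" if "x \<in> wmap w ` A" "y \<in> wmap w ` A" for x y
    proof -
      obtain a b where "x = wmap w a" "y = wmap w b" using \<open>x \<in> _\<close> \<open>y \<in> _\<close> by blast
      then have "dist x y \<le> c ^ n * dist a b"
        using wmap_contract[OF w(1)] w(2) by simp
      also have "\<dots> \<le> c ^ n * R"
        using R(2) c_pos by (intro mult_left_mono) auto
      finally show ?thesis by (simp add: mult.commute)
    qed
    then show "diameter (wmap w ` A) \<le> R * c ^ n"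
      using R(1) c_pos by (intro diameter_leI) auto
    show "bounded (wmap w ` A)"
      unfolding bounded_two_points using R(2) by blast
    then show "0 \<le> diameter (wmap w ` A)"
      by (rule diameter_ge_0)
  qed
  have sum_le: "(\<Sum>w\<in>words N n. diameter (wmap w ` A) powr s) \<le> bound n" for n
  proof -
    have "(\<Sum>w\<in>words N n. diameter (wmap w ` A) powr s)
        \<le> (\<Sum>w\<in>words N n. ((C * B) * (1 + e) ^ n * wderiv w x0) powr s)"
      using diam \<open>0 < s\<close> by (intro sum_mono powr_mono2) auto
    also have "\<dots> = (\<Sum>w\<in>words N n. ((C * B) powr s * ((1 + e) ^ n) powr s) * wderiv w x0 powr s)"
    proof (intro sum.cong refl)
      fix w assume "w \<in> words N n"
      then have "0 < wderiv w x0" using wderiv_pos words_subset by blast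
      then show "((C * B) * (1 + e) ^ n * wderiv w x0) powr s
          = ((C * B) powr s * ((1 + e) ^ n) powr s) * wderiv w x0 powr s"
        using C(1) B(1) e by (simp add: powr_mult)
    qed
    also have "\<dots> = (C * B) powr s * ((1 + e) ^ n) powr s * partition_sum s n x0"
      by (simp add: partition_sum_def sum_distrib_left)
    also have "\<dots> \<le> (C * B) powr s * ((1 + e) ^ n) powr s * exp (real n * pressure s + k)"
      by (intro mult_left_mono k) auto
    also have "((1 + e) ^ n) powr s = exp (- (real n * pressure s / 2))"
      using \<open>0 < s\<close> by (simp add: one_e powr_def ln_realpow)
    also have "(C * B) powr s * exp (- (real n * pressure s / 2)) * exp (real n * pressure s + k)
        = bound n"
      by (simp add: bound_def exp_of_nat_mult[symmetric] mult.assoc exp_add[symmetric])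
    finally show ?thesis .
  qed
  have "bound \<longlonglongrightarrow> (C * B) powr s * exp k * 0"
    unfolding bound_def using assms(3) by (intro tendsto_intros LIMSEQ_power_zero) auto
  moreover have "(\<lambda>n. R * c ^ n) \<longlonglongrightarrow> R * 0"
    using c_pos c_less_1 by (intro tendsto_intros LIMSEQ_power_zero) auto
  ultimately have "\<forall>\<^sub>F n in sequentially. bound n < \<eta> \<and> R * c ^ n < \<delta>"
    using \<open>0 < \<delta>\<close> \<open>0 < \<eta>\<close> by (intro eventually_conj order_tendstoD(2)) auto
  then obtain n where n: "bound n < \<eta>" "R * c ^ n < \<delta>"
    by (auto simp: eventually_sequentially)
  show "\<exists>(I :: nat list set) C. finite I \<and> A \<subseteq> (\<Union>i\<in>I. C i) \<and>
      (\<forall>i\<in>I. bounded (C i) \<and> diameter (C i) \<le> \<delta>) \<and> (\<Sum>i\<in>I. diameter (C i) powr s) \<le> \<eta>"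
  proof (intro exI[of _ "words N n"] exI[of _ "\<lambda>w. wmap w ` A"] conjI ballI)
    show "A \<subseteq> (\<Union>w\<in>words N n. wmap w ` A)"
      using attractor_words[OF cover] by blast
    show "diameter (wmap w ` A) \<le> \<delta>" if "w \<in> words N n" for w
      using diam(2)[OF that] n(2) by linarith
    show "bounded (wmap w ` A)" if "w \<in> words N n" for w
      using diam(3)[OF that] .
    show "(\<Sum>w\<in>words N n. diameter (wmap w ` A) powr s) \<le> \<eta>"
      using sum_le[of n] n(1) by linarith
  qed simp
qed

section \<open>Lower bound for the dimension: a separated subsystem\<close>

lemma wmap_in:
  assumes "\<And>i. i \<in> {1..N} \<Longrightarrow> f i ` A \<subseteq> A" and "set w \<subseteq> {1..N}" and "x \<in> A"
  shows "wmap w x \<in> A"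
  using assms(2,3) assms(1) by (induction w) auto

lemma continuous_wmap:
  assumes "set w \<subseteq> {1..N}"
  shows "continuous_on S (wmap w)"
proof -
  have "1-lipschitz_on S (wmap w)"
    using wmap_dist_le[OF assms] by (intro lipschitz_onI) auto
  then show ?thesis by (rule lipschitz_on_continuous_on)
qed

text \<open>Injectivity is only available on \<open>A\<close>, hence the restriction to \<open>A \<inter> U\<close>.\<close>

lemma wmap_disjoint:
  assumes inv: "\<And>i. i \<in> {1..N} \<Longrightarrow> f i ` A \<subseteq> A" and inj: "\<And>i. i \<in> {1..N} \<Longrightarrow> inj_on (f i) A"
    and U: "\<And>i. i \<in> {1..N} \<Longrightarrow> f i ` U \<subseteq> U"
    and disj: "\<And>i j. i \<in> {1..N} \<Longrightarrow> j \<in> {1..N} \<Longrightarrow> i \<noteq> j \<Longrightarrow> f i ` U \<inter> f j ` U = {}"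
    and xy: "x \<in> A \<inter> U" "y \<in> A \<inter> U"
  shows "v \<in> words N n \<Longrightarrow> w \<in> words N n \<Longrightarrow> v \<noteq> w \<Longrightarrow> wmap v x \<noteq> wmap w y"
proof (induction n arbitrary: v w)
  case (Suc n)
  obtain i v' where v: "v = i # v'" "i \<in> {1..N}" "v' \<in> words N n"
    using Suc.prems(1) by (auto simp: words_def length_Suc_conv)
  obtain j w' where w: "w = j # w'" "j \<in> {1..N}" "w' \<in> words N n"
    using Suc.prems(2) by (auto simp: words_def length_Suc_conv)
  have mem: "wmap v' x \<in> A" "wmap v' x \<in> U" "wmap w' y \<in> A" "wmap w' y \<in> U"
    using xy v w words_subset wmap_in[OF inv] wmap_in[OF U] by blast+
  show ?case
  \<comment> \<open>Equal first letters cancel by injectivity on \<open>A\<close>; different ones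
    send points of \<open>U\<close> into disjoint sets. The orbits must therefore stay in both
    sets.\<close>
  proof (cases "i = j")
    case True
    then have "wmap v' x \<noteq> wmap w' y"
      using Suc v w by blast
    then show ?thesis
      using inj_onD[OF inj[OF v(2)]] mem(1,3) v(1) w(1) True by auto
  next
    case False
    then show ?thesis
      using disj[OF v(2) w(2)] mem(2,4) v(1) w(1) by auto
  qed
qed simp

text \<open>Close pairs are handled by the near-similitude bound. The pairs at distance at least
  \<open>\<delta>\<close> form a compact set, on which injectivity keeps the images a positive
  distance apart.\<close>

lemma map_lower_lipschitz:
  assumes "compact A" and i: "i \<in> {1..N}" and inj: "inj_on (f i) A"
  obtains \<kappa> where "0 < \<kappa>" "\<And>x y. x \<in> A \<Longrightarrow> y \<in> A \<Longrightarrow> \<kappa> * dist x y \<le> dist (f i x) (f i y)"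
proof -
  obtain m where m: "0 < m" "m \<le> 1" "\<And>i x. i \<in> {1..N} \<Longrightarrow> m \<le> D i x"
    using deriv_lower_bound by metis
  obtain R where R: "0 < R" "\<And>x y :: 'a. dist x y \<le> R"
    using diameter_bound by metis
  obtain \<delta> where \<delta>: "0 < \<delta>"
    "\<And>x y. dist x y < \<delta> \<Longrightarrow> (1 - 1 / 2) * D i x * dist x y \<le> dist (f i x) (f i y)"
    using local_similitude_ratio[of "1 / 2"] i by (metis half_gt_zero zero_less_one)
  define K where "K = (A \<times> A) \<inter> {p. \<delta> \<le> dist (fst p) (snd p)}"
  have "compact K"
    unfolding K_def using \<open>compact A\<close>
    by (intro compact_Int_closed compact_Times closed_Collect_le continuous_intros)
  have "\<exists>\<mu>>0. \<forall>p\<in>K. \<mu> \<le> dist (f i (fst p)) (f i (snd p))"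
  proof (cases "K = {}")
    case True
    then show ?thesis by (intro exI[of _ 1]) simp
  next
    case False
    have "continuous_on K (\<lambda>p. dist (f i (fst p)) (f i (snd p)))"
      by (intro continuous_on_dist continuous_on_compose2[OF continuous_map[OF i, of UNIV]]
          continuous_intros) auto
    then obtain p where p: "p \<in> K"
      "\<And>q. q \<in> K \<Longrightarrow> dist (f i (fst p)) (f i (snd p)) \<le> dist (f i (fst q)) (f i (snd q))"
      using continuous_attains_inf[OF \<open>compact K\<close> False] by blast
    have "fst p \<noteq> snd p" "fst p \<in> A" "snd p \<in> A"
      using p(1) \<delta>(1) by (auto simp: K_def)
    then have "f i (fst p) \<noteq> f i (snd p)"
      using inj_onD[OF inj] by blast
    with p(2) show ?thesis
      by (intro exI[of _ "dist (f i (fst p)) (f i (snd p))"]) auto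
  qed
  then obtain \<mu> where \<mu>: "0 < \<mu>" "\<And>x y. (x, y) \<in> K \<Longrightarrow> \<mu> \<le> dist (f i x) (f i y)"
    by force
  \<comment> \<open>\<open>m / 2\<close> serves the close pairs, with relative error 1/2;
    \<open>\<mu> / R\<close> serves the far ones, whose distance is at most
    \<open>R\<close>.\<close>
  define \<kappa> where "\<kappa> = min (m / 2) (\<mu> / R)"
  show thesis
  proof
    show "0 < \<kappa>"
      using m \<mu> R by (simp add: \<kappa>_def)
    fix x y assume xy: "x \<in> A" "y \<in> A"
    show "\<kappa> * dist x y \<le> dist (f i x) (f i y)"
    proof (cases "dist x y < \<delta>")
      case True
      have "\<kappa> * dist x y \<le> (1 - 1 / 2) * D i x * dist x y"
        using m(3)[OF i, of x] min.cobounded1[of "m / 2" "\<mu> / R"]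
        by (intro mult_right_mono) (auto simp: \<kappa>_def)
      with \<delta>(2)[OF True] show ?thesis by linarith
    next
      case False
      have "\<kappa> * dist x y \<le> \<mu> / R * R"
        using R \<mu>(1) by (intro mult_mono) (auto simp: \<kappa>_def)
      also have "\<dots> \<le> dist (f i x) (f i y)"
        using R(1) \<mu>(2)[of x y] xy False by (simp add: K_def)
      finally show ?thesis .
    qed
  qed
qed

text \<open>Used for one fixed word, so that \<open>\<kappa>\<close> may depend on it without
  harm.\<close>

lemma wmap_lower_lipschitz:
  assumes "compact A" and inv: "\<And>i. i \<in> {1..N} \<Longrightarrow> f i ` A \<subseteq> A"
    and inj: "\<And>i. i \<in> {1..N} \<Longrightarrow> inj_on (f i) A" and "set w \<subseteq> {1..N}"
  shows "\<exists>\<kappa>>0. \<forall>x\<in>A. \<forall>y\<in>A. \<kappa> * dist x y \<le> dist (wmap w x) (wmap w y)"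
  using assms(4)
proof (induction w)
  case Nil
  show ?case by (intro exI[of _ 1]) simp
next
  case (Cons i w)
  then obtain \<kappa> where \<kappa>: "0 < \<kappa>" "\<And>x y. x \<in> A \<Longrightarrow> y \<in> A \<Longrightarrow> \<kappa> * dist x y \<le> dist (wmap w x) (wmap w y)"
    by auto
  have i: "i \<in> {1..N}" and w: "set w \<subseteq> {1..N}"
    using Cons.prems by auto
  obtain \<mu> where \<mu>: "0 < \<mu>" "\<And>x y. x \<in> A \<Longrightarrow> y \<in> A \<Longrightarrow> \<mu> * dist x y \<le> dist (f i x) (f i y)"
    using map_lower_lipschitz[OF \<open>compact A\<close> i inj[OF i]] by metis
  have "\<mu> * \<kappa> * dist x y \<le> dist (wmap (i # w) x) (wmap (i # w) y)" if "x \<in> A" "y \<in> A" for x y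
  proof -
    have "\<mu> * (\<kappa> * dist x y) \<le> \<mu> * dist (wmap w x) (wmap w y)"
      using \<kappa>(2)[OF that] \<mu>(1) by (intro mult_left_mono) auto
    also have "\<dots> \<le> dist (wmap (i # w) x) (wmap (i # w) y)"
      using \<mu>(2) wmap_in[OF inv w] that by simp
    finally show ?thesis by (simp add: mult.assoc)
  qed
  then show ?case
    using \<kappa>(1) \<mu>(1) by (intro exI[of _ "\<mu> * \<kappa>"]) auto
qed

text \<open>
  As in Schief's argument, fix a word \<open>w\<close> whose cylinder lies in \<open>U\<close>.  For the words \<open>v\<close> of a
  fixed large length the maps \<open>v w\<close> have disjoint images of \<open>A\<close>, and the cylinder of \<open>w\<close> is so
  small that the contraction ratio of \<open>v\<close> on it is \<open>wderiv v\<close> up to a subexponential factor.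
\<close>

lemma hausdorff_measure_attractor_neq_0:
  assumes "compact A" and A: "A = (\<Union>i\<in>{1..N}. f i ` A)"
    and inj: "\<And>i. i \<in> {1..N} \<Longrightarrow> inj_on (f i) A"
    and "strong_open_set_condition N f A"
    and "0 < s" and "0 < pressure s"
  shows "hausdorff_measure s A \<noteq> 0"
proof -
  obtain U where "open U" "U \<inter> A \<noteq> {}"
    and U: "\<And>i. i \<in> {1..N} \<Longrightarrow> f i ` U \<subseteq> U"
    and disj: "\<And>i j. i \<in> {1..N} \<Longrightarrow> j \<in> {1..N} \<Longrightarrow> i \<noteq> j \<Longrightarrow> f i ` U \<inter> f j ` U = {}"
    using assms(4) unfolding strong_open_set_condition_def by metis
  have inv: "\<And>i. i \<in> {1..N} \<Longrightarrow> f i ` A \<subseteq> A" using A by blast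
  obtain a where a: "a \<in> A" "a \<in> U" using \<open>U \<inter> A \<noteq> {}\<close> by blast
  obtain \<rho> where \<rho>: "0 < \<rho>" "ball a \<rho> \<subseteq> U"
    using \<open>open U\<close> a(2) by (meson openE)
  obtain R where R: "0 < R" "\<And>x y :: 'a. dist x y \<le> R"
    using diameter_bound by metis
  obtain B where B: "1 \<le> B" "\<And>w x y. set w \<subseteq> {1..N} \<Longrightarrow> wderiv w x \<le> B * wderiv w y"
    using bounded_distortion by metis
  obtain k where k: "\<And>n x. exp (real n * pressure s - k) \<le> partition_sum s n x"
    using pressure[of s] \<open>0 < s\<close> by (metis less_imp_le)
  \<comment> \<open>Now \<open>((1 - e) ^ n) powr s\<close> equals
    \<open>exp (- n * pressure s / 2)\<close>, so half of the growth of the partition sum is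
    kept.\<close>
  define e where "e = 1 - exp (- pressure s / (2 * s))"
  have e: "0 < e" "e < 1" and one_e: "1 - e = exp (- pressure s / (2 * s))"
    using assms(5,6) by (auto simp: e_def divide_pos_pos)
  obtain \<delta> where \<delta>: "0 < \<delta>"
    "\<And>w x y. set w \<subseteq> {1..N} \<Longrightarrow> dist x y < \<delta> \<Longrightarrow>
      (1 - e) ^ length w * wderiv w x * dist x y \<le> dist (wmap w x) (wmap w y)"
    using wmap_lower[OF e] by metis
  \<comment> \<open>Below \<open>\<rho>\<close> the cylinder around \<open>a\<close> fits into
    \<open>U\<close>; below \<open>\<delta>\<close> the estimate \<open>wmap_lower\<close> applies
    to all pairs of its points.\<close>
  obtain M where M: "c ^ M < min \<rho> \<delta> / R"
    using real_arch_pow_inv[of "min \<rho> \<delta> / R" c] \<rho>(1) \<delta>(1) R(1) c_less_1 by auto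
  obtain w b where w: "w \<in> words N M" and b: "a = wmap w b"
    using attractor_words[of A a M] A a(1) by blast
  have small: "dist (wmap w x) (wmap w y) < min \<rho> \<delta>" for x y
  proof -
    have "dist (wmap w x) (wmap w y) \<le> c ^ M * dist x y"
      using wmap_contract[OF words_subset[OF w]] words_length[OF w] by simp
    also have "\<dots> \<le> c ^ M * R"
      using R c_pos by (intro mult_left_mono) auto
    also have "\<dots> < min \<rho> \<delta>"
      using M R(1) by (simp add: pos_less_divide_eq)
    finally show ?thesis .
  qed
  have wU: "wmap w x \<in> U" for x
    using small[of b x] \<rho>(2) b by (auto simp: subset_iff)
  obtain \<kappa> where \<kappa>: "0 < \<kappa>" "\<And>x y. x \<in> A \<Longrightarrow> y \<in> A \<Longrightarrow> \<kappa> * dist x y \<le> dist (wmap w x) (wmap w y)"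
    using wmap_lower_lipschitz[OF \<open>compact A\<close> inv inj words_subset[OF w]] by blast
  \<comment> \<open>The remaining half of the growth must beat \<open>\<kappa>\<close>,
    \<open>B\<close> and \<open>k\<close>, all fixed before \<open>n\<close>. With
    \<open>1 \<le> n\<close> there are at least two words.\<close>
  obtain n :: nat where n: "k - s * ln (\<kappa> / B) < real n * (pressure s / 2)" "1 \<le> n"
  proof -
    obtain n :: nat where "k - s * ln (\<kappa> / B) < real n * (pressure s / 2)"
      using reals_Archimedean3[of "pressure s / 2"] assms(6) half_gt_zero by blast
    also have "\<dots> \<le> real (Suc n) * (pressure s / 2)"
      using assms(6) by (intro mult_right_mono) auto
    finally show thesis using that[of "Suc n"] by simp
  qed
  define x0 :: 'a where "x0 = undefined"
  define g where "g v x = wmap v (wmap w x)" for v x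
  \<comment> \<open>The factors are the near-similitude loss of \<open>v\<close>, the contraction
    \<open>\<kappa>\<close> of the fixed word, and \<open>1 / B\<close> for moving the base point to
    \<open>x0\<close>.\<close>
  define r where "r v = (1 - e) ^ n * (\<kappa> / B) * wderiv v x0" for v
  have g_in: "g v x \<in> A" if "v \<in> words N n" "x \<in> A" for v x
    unfolding g_def by (intro wmap_in[OF inv] words_subset[OF that(1)] words_subset[OF w] that(2))
  have r_pos: "0 < r v" if "v \<in> words N n" for v
    using e \<kappa>(1) B(1) wderiv_pos[OF words_subset[OF that]] by (simp add: r_def)
  have g_lower: "r v * dist x y \<le> dist (g v x) (g v y)" if "v \<in> words N n" "x \<in> A" "y \<in> A" for v x y
  proof -
    note v = words_subset[OF that(1)]
    have "wderiv v x0 / B \<le> wderiv v (wmap w x)"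
      using B(2)[OF v, of x0 "wmap w x"] B(1) by (simp add: divide_le_eq mult.commute)
    then have "(1 - e) ^ n * (wderiv v x0 / B) * (\<kappa> * dist x y)
        \<le> (1 - e) ^ n * wderiv v (wmap w x) * dist (wmap w x) (wmap w y)"
      using \<kappa>(1) \<kappa>(2)[OF that(2,3)] e wderiv_pos[OF v] B(1) less_imp_le[OF wderiv_pos[OF v]]
      by (intro mult_mono) auto
    also have "\<dots> \<le> dist (g v x) (g v y)"
      using \<delta>(2)[OF v, of "wmap w x" "wmap w y"] small[of x y] words_length[OF that(1)]
      by (simp add: g_def)
    finally show ?thesis by (simp add: r_def mult_ac)
  qed
  have sum_r: "1 \<le> (\<Sum>v\<in>words N n. r v powr s)"
  proof -
    have "(\<Sum>v\<in>words N n. r v powr s)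
        = (\<Sum>v\<in>words N n. ((1 - e) ^ n) powr s * (\<kappa> / B) powr s * wderiv v x0 powr s)"
    proof (intro sum.cong refl)
      fix v assume "v \<in> words N n"
      then have "0 < wderiv v x0" using wderiv_pos words_subset by blast
      moreover have "0 \<le> (1 - e) ^ n" "0 \<le> \<kappa> / B" using e \<kappa>(1) B(1) by auto
      ultimately show "r v powr s = ((1 - e) ^ n) powr s * (\<kappa> / B) powr s * wderiv v x0 powr s"
        by (simp add: r_def powr_mult del: times_divide_eq_right)
    qed
    also have "\<dots> = ((1 - e) ^ n) powr s * (\<kappa> / B) powr s * partition_sum s n x0"
      by (simp add: partition_sum_def sum_distrib_left)
    also have "((1 - e) ^ n) powr s = exp (- (real n * pressure s / 2))"
      using \<open>0 < s\<close> by (simp add: one_e powr_def ln_realpow)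
    also have "(\<kappa> / B) powr s = exp (s * ln (\<kappa> / B))"
      using \<kappa>(1) B(1) by (simp add: powr_def)
    finally have eq: "(\<Sum>v\<in>words N n. r v powr s)
        = exp (- (real n * pressure s / 2)) * exp (s * ln (\<kappa> / B)) * partition_sum s n x0" .
    have "1 \<le> exp (- (real n * pressure s / 2) + s * ln (\<kappa> / B) + (real n * pressure s - k))"
      using n(1) by (simp add: algebra_simps)
    also have "\<dots> \<le> exp (- (real n * pressure s / 2)) * exp (s * ln (\<kappa> / B)) * partition_sum s n x0"
      unfolding exp_add by (intro mult_left_mono k) auto
    finally show ?thesis by (simp add: eq)
  qed
  \<comment> \<open>A single map has pressure \<open>ln 1 = 0\<close> at 0 and negative pressure
    beyond, so a positive value at \<open>s\<close> forces two maps.\<close>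
  have "0 < ln (real N)"
    using pressure_strict_antimono[of 0 s] assms(5,6) by (simp add: pressure_0)
  then have "2 \<le> N" using N_pos by (cases "N = 1") auto
  then have card: "2 \<le> card (words N n)"
    using n(2) power_increasing[of 1 n N] by (simp add: card_words)
  have E: "compact (g v ` A)" if "v \<in> words N n" for v
  proof (rule compact_continuous_image[OF _ \<open>compact A\<close>])
    show "continuous_on A (g v)"
      unfolding g_def
      by (rule continuous_on_compose2[OF continuous_wmap[of v UNIV] continuous_wmap[of w]])
        (use words_subset that w in auto)
  qed
  have E_disjoint: "g v ` A \<inter> g v' ` A = {}" if "v \<in> words N n" "v' \<in> words N n" "v \<noteq> v'" for v v'
  proof -
    have "wmap w x \<in> A \<inter> U" if "x \<in> A" for x
      using wU wmap_in[OF inv words_subset[OF w] that] by blast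
    then have "g v x \<noteq> g v' y" if "x \<in> A" "y \<in> A" for x y
      unfolding g_def using wmap_disjoint[OF inv inj U disj] \<open>v \<in> _\<close> \<open>v' \<in> _\<close> \<open>v \<noteq> v'\<close> that
      by blast
    then show ?thesis by blast
  qed
  have "\<exists>\<Delta>>0. \<forall>v\<in>words N n. \<forall>v'\<in>words N n. v \<noteq> v' \<longrightarrow>
      (\<forall>x\<in>g v ` A. \<forall>y\<in>g v' ` A. \<Delta> \<le> dist x y)"
    by (rule compact_disjoint_family_gap[OF finite_words E E_disjoint])
  then obtain \<Delta> where \<Delta>: "0 < \<Delta>" and gap: "\<forall>v\<in>words N n. \<forall>v'\<in>words N n. v \<noteq> v' \<longrightarrow>
      (\<forall>x\<in>g v ` A. \<forall>y\<in>g v' ` A. \<Delta> \<le> dist x y)"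
    by (elim exE conjE)
  have "ennreal (\<Delta> powr s) \<le> hausdorff_premeasure s 1 A"
  proof (rule hausdorff_premeasure_ge[OF \<open>compact A\<close> \<open>0 < s\<close>])
    fix V :: "nat \<Rightarrow> 'a set" and J
    assume V: "finite J" "A \<subseteq> (\<Union>j\<in>J. V j)" "\<forall>j\<in>J. bounded (V j)"
    have "A \<noteq> {}" using a by blast
    show "\<Delta> powr s \<le> (\<Sum>j\<in>J. diameter (V j) powr s)"
      by (rule finite_cover_diameter_sum[OF finite_words card \<open>A \<noteq> {}\<close> \<open>0 < s\<close> \<Delta>
            g_in _ r_pos g_lower sum_r V]) (use gap in auto)
  qed
  also have "\<dots> \<le> hausdorff_measure s A"
    unfolding hausdorff_measure_def by (rule SUP_upper) simp
  finally have "ennreal (\<Delta> powr s) \<le> hausdorff_measure s A" .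
  moreover have "0 < ennreal (\<Delta> powr s)"
    using \<Delta> by simp
  ultimately show ?thesis by (metis leD)
qed

text \<open>Strict monotonicity of the pressure turns its sign at \<open>s\<close> into the position
  of \<open>s\<close> relative to \<open>\<sigma>\<close>. For a single map \<open>\<sigma>\<close>
  is 0 and no smaller exponent remains to be excluded.\<close>

lemma hausdorff_dim_attractor:
  assumes "compact A" and "A \<noteq> {}" and A: "A = (\<Union>i\<in>{1..N}. f i ` A)"
    and inj: "\<And>i. i \<in> {1..N} \<Longrightarrow> inj_on (f i) A"
    and sosc: "strong_open_set_condition N f A"
    and "0 \<le> \<sigma>" and "pressure \<sigma> = 0"
  shows "hausdorff_dim A = ereal \<sigma>"
proof (rule antisym)
  show "hausdorff_dim A \<le> ereal \<sigma>"
  proof (rule ereal_le_epsilon2)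
    fix e :: real assume "0 < e"
    then have "hausdorff_measure (\<sigma> + e) A = 0"
      using pressure_strict_antimono[of \<sigma> "\<sigma> + e"] assms(6,7) A
      by (intro hausdorff_measure_attractor_eq_0) auto
    then show "hausdorff_dim A \<le> ereal \<sigma> + ereal e"
      unfolding hausdorff_dim_def using \<open>0 \<le> \<sigma>\<close> \<open>0 < e\<close>
      by (intro Inf_lower) (auto intro!: exI[of _ "\<sigma> + e"])
  qed
  show "ereal \<sigma> \<le> hausdorff_dim A"
    unfolding hausdorff_dim_def
  proof (rule Inf_greatest, clarify)
    fix s :: real assume s: "0 \<le> s" "hausdorff_measure s A = 0"
    show "ereal \<sigma> \<le> ereal s"
    proof (rule ccontr)
      assume "\<not> ereal \<sigma> \<le> ereal s"
      then have "0 < pressure s"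
        using pressure_strict_antimono[of s \<sigma>] s(1) assms(7) by simp
      moreover have "s \<noteq> 0"
        using hausdorff_measure_0_neq_0[OF \<open>A \<noteq> {}\<close>] s(2) by auto
      ultimately show False
        using hausdorff_measure_attractor_neq_0[OF assms(1) A inj sosc, of s] s by auto
    qed
  qed
qed

end

theorem theorem2p12:
  fixes f :: "nat \<Rightarrow> 'a::{metric_space, perfect_space} \<Rightarrow> 'a"
    and c :: "nat \<Rightarrow> real"
    and N :: nat
    and A :: "'a set"
  assumes "compact (UNIV :: 'a set)"
    and "\<forall>i\<in>{1..N}. inf_similitude (f i)"
    and "\<forall>i\<in>{1..N}. (\<forall>x. 0 < inf_deriv (f i) x) \<and> hoelder_continuous (inf_deriv (f i))"
    and "\<forall>i\<in>{1..N}. contraction_with (c i) (f i)"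
    and "compact A" and "A \<noteq> {}" and "A = (\<Union>i\<in>{1..N}. f i ` A)"
    and "\<forall>i\<in>{1..N}. inj_on (f i) A"
    and "strong_open_set_condition N f A"
  shows "\<exists>\<sigma>\<^sub>0. 0 \<le> \<sigma>\<^sub>0 \<and> op_spectral_radius (transfer_op N f \<sigma>\<^sub>0) = 1 \<and>
    (\<forall>\<sigma>. 0 \<le> \<sigma> \<and> op_spectral_radius (transfer_op N f \<sigma>) = 1 \<longrightarrow> \<sigma> = \<sigma>\<^sub>0) \<and>
    hausdorff_dim A = ereal \<sigma>\<^sub>0"
proof -
  \<comment> \<open>The inserted 1/2 makes \<open>C\<close> positive, since
    \<open>contraction_with\<close> bounds the coefficients only from above.\<close>
  define C where "C = Max (insert (1 / 2) (c ` {1..N}))"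
  have C: "c i \<le> C" if "i \<in> {1..N}" for i
    unfolding C_def using that by (intro Max_ge) auto
  have "1 / 2 \<le> C"
    unfolding C_def by (intro Max_ge) auto
  then have "0 < C" by simp
  have "C < 1"
    unfolding C_def using assms(4) by (subst Max_less_iff) (auto simp: contraction_with_def)
  interpret infinitesimal_ifs f N C
  proof
    \<comment> \<open>For \<open>N = 0\<close> the union, and with it \<open>A\<close>, would be
      empty.\<close>
    show "1 \<le> N"
      using assms(6,7) by (cases N) auto
    show "dist (f i x) (f i y) \<le> C * dist x y" if "i \<in> {1..N}" for i x y
    proof -
      have "dist (f i x) (f i y) \<le> c i * dist x y"
        using assms(4) that by (auto simp: contraction_with_def)
      also have "\<dots> \<le> C * dist x y"
        using C[OF that] by (intro mult_right_mono) auto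
      finally show ?thesis .
    qed
  qed (use assms(1-3) \<open>0 < C\<close> \<open>C < 1\<close> in auto)
  obtain \<sigma>0 where \<sigma>0: "0 \<le> \<sigma>0" "pressure \<sigma>0 = 0"
    using pressure_zero_exists by blast
  have "\<sigma> = \<sigma>0" if "0 \<le> \<sigma>" "op_spectral_radius (transfer_op N f \<sigma>) = 1" for \<sigma>
    using op_spectral_radius_transfer_op[OF that(1)] pressure_strict_antimono[of \<sigma> \<sigma>0] pressure_strict_antimono[of \<sigma>0 \<sigma>] \<sigma>0 that
    by (cases \<sigma> \<sigma>0 rule: linorder_cases) auto
  moreover have "hausdorff_dim A = ereal \<sigma>0"
    using assms(5-9) \<sigma>0 by (intro hausdorff_dim_attractor) auto
  moreover have "op_spectral_radius (transfer_op N f \<sigma>0) = 1"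
    using op_spectral_radius_transfer_op[OF \<sigma>0(1)] \<sigma>0(2) by simp
  ultimately show ?thesis
    using \<sigma>0(1) by blast
qed

end
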